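(* Let $X=(X_n)_{n\in\mathbb Z}$ be a stationary process with values in a finite set $A$, and let $(\delta_n)_{n\ge0}$ be defined from a fixed regular version of the conditional law of $X_0$ given $X^{\lhd}_{-1}$ as in the context. (1) If $2\delta_0<1$ and $$\sum_{k=0}^{+\infty}\prod_{n=0}^{k}(1-2\delta_n)=+\infty,$$ then the natural filtration $\mathcal F^X$ is standard. (2) If $A$ has exactly two elements and $$\sum_{k=0}^{+\infty}\prod_{n=0}^{k}(1-\delta_n)=+\infty,$$ then $\mathcal F^X$ is standard.
   Context: All $\sigma$-fields are complete. For a process $\xi$, $\xi^{\lhd}_n=(\xi_k)_{k\le n}$, $\mathcal F^\xi_n=\sigma(\xi^{\lhd}_n)$, and $\mathcal F^\xi=(\mathcal F^\xi_n)_{n\in\mathbb Z}$. For $i\le j$, $\xi_{i:j}=(\xi_n)_{i\le n\le j}$. $A^{\lhd}$ is the set of sequences $(x_n)_{n\le -1}$ with values in $A$; a sequence $(\xi_n)_{n\le i}$ is identified with the element of $A^\lhd$ obtained by shifting indices so that the last term has index $-1$. For $x\in A^\lhd$ and $z=(z_1,\dots,z_n)\in A^n$, $xz=(\dots,x_{-2},x_{-1},z_1,\dots,z_n)\in A^\lhd$. Let $p(\cdot|x)$, $x\in A^\lhd$, be a (fixed) regular version of the conditional law of $X_0$ given $X^{\lhd}_{-1}=x$. For probabilities $\mu,\nu$ on $A$, $\|\mu-\nu\|=\frac12\sum_{a}|\mu(a)-\nu(a)|$. For $n\ge0$, $$\delta_n=\sup\{\|p(\cdot|xz)-p(\cdot|yz)\|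 : x,y\in A^\lhd,\ z\in A^n\}.$$ A filtration $\mathcal F^X$ is standard if, possibly after enlarging the probability space, it is immersed in the natural filtration of some i.i.d. process, where $\mathcal F^X$ is immersed in $\mathcal G$ means $\mathcal F^X_n\subset\mathcal G_n$ for all $n$ and, for every $n$, $\mathcal F^X_{n+1}$ and $\mathcal G_n$ are independent conditionally on $\mathcal F^X_n$. *)

theory Defs
  imports "HOL-Probability.Probability"
begin

text \<open>An element x of A-triangle (sequences indexed by n <= -1) is represented as
  a function nat => 'a with  x m = x_{-(m+1)}.  A finite word z = (z_1,...,z_n)
  is a list of length n.\<close>

definition past_concat :: "(nat \<Rightarrow> 'a) \<Rightarrow> 'a list \<Rightarrow> (nat \<Rightarrow> 'a)" where
  "past_concat x z = (\<lambda>m. if m < length z then rev z ! m else x (m - length z))"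

definition past_space :: "(nat \<Rightarrow> 'a) measure" where
  "past_space = PiM UNIV (\<lambda>_. count_space UNIV)"

definition past_of :: "(int \<Rightarrow> 'w \<Rightarrow> 'a) \<Rightarrow> 'w \<Rightarrow> (nat \<Rightarrow> 'a)" where
  "past_of X \<omega> = (\<lambda>m. X (- int m - 1) \<omega>)"

definition tv_dist :: "('a::finite \<Rightarrow> real) \<Rightarrow> ('a \<Rightarrow> real) \<Rightarrow> real" where
  "tv_dist \<mu> \<nu> = (1/2) * (\<Sum>a\<in>UNIV. \<bar>\<mu> a - \<nu> a\<bar>)"

definition delta :: "((nat \<Rightarrow> 'a::finite) \<Rightarrow> 'a \<Rightarrow> real) \<Rightarrow> nat \<Rightarrow> real" where
  "delta p n = Sup {tv_dist (p (past_concat x z)) (p (past_concat y z)) | x y z. length z = n}"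

definition stationary :: "'w measure \<Rightarrow> (int \<Rightarrow> 'w \<Rightarrow> 'a) \<Rightarrow> bool" where
  "stationary M X \<longleftrightarrow>
     (\<forall>k::int. distr M (PiM UNIV (\<lambda>_::int. count_space UNIV)) (\<lambda>\<omega> n. X (n + k) \<omega>)
             = distr M (PiM UNIV (\<lambda>_::int. count_space UNIV)) (\<lambda>\<omega> n. X n \<omega>))"

definition regular_cond_law ::
  "'w measure \<Rightarrow> (int \<Rightarrow> 'w \<Rightarrow> 'a::finite) \<Rightarrow> ((nat \<Rightarrow> 'a) \<Rightarrow> 'a \<Rightarrow> real) \<Rightarrow> bool" where
  "regular_cond_law M X p \<longleftrightarrow>
     (\<forall>x a. 0 \<le> p x a) \<and> (\<forall>x. (\<Sum>a\<in>UNIV. p x a) = 1) \<and>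
     (\<forall>a. (\<lambda>x. p x a) \<in> borel_measurable past_space) \<and>
     (\<forall>a. \<forall>B\<in>sets past_space.
        measure M {\<omega> \<in> space M. X 0 \<omega> = a \<and> past_of X \<omega> \<in> B}
          = (\<integral>\<omega>. indicator B (past_of X \<omega>) * p (past_of X \<omega>) a \<partial>M))"

definition gen_filt :: "'b measure \<Rightarrow> 'c measure \<Rightarrow> (int \<Rightarrow> 'b \<Rightarrow> 'c) \<Rightarrow> int \<Rightarrow> 'b measure" where
  "gen_filt N S Y n = sigma (space N)
     ({Y k -` B \<inter> space N | k B. k \<le> n \<and> B \<in> sets S} \<union> null_sets (completion N))"

definition cond_indep_given :: "'b measure \<Rightarrow> 'b measure \<Rightarrow> 'b measure \<Rightarrow> 'b measure \<Rightarrow> bool" where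
  "cond_indep_given N F G H \<longleftrightarrow>
     (\<forall>A\<in>sets F. \<forall>B\<in>sets G. AE \<omega> in N.
        real_cond_exp N H (indicator (A \<inter> B)) \<omega>
          = real_cond_exp N H (indicator A) \<omega> * real_cond_exp N H (indicator B) \<omega>)"

definition immersed :: "'b measure \<Rightarrow> 'c measure \<Rightarrow> (int \<Rightarrow> 'b \<Rightarrow> 'c) \<Rightarrow>
                        'd measure \<Rightarrow> (int \<Rightarrow> 'b \<Rightarrow> 'd) \<Rightarrow> bool" where
  "immersed N S Y T U \<longleftrightarrow>
     (\<forall>n. sets (gen_filt N S Y n) \<subseteq> sets (gen_filt N T U n) \<and>
          cond_indep_given (completion N) (gen_filt N S Y (n + 1)) (gen_filt N T U n) (gen_filt N S Y n))"

definition standard_filtration :: "'w measure \<Rightarrow> (int \<Rightarrow> 'w \<Rightarrow> 'a) \<Rightarrow> bool" where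
  "standard_filtration M X \<longleftrightarrow>
     (\<exists>(N :: ('w \<times> (int \<Rightarrow> real)) measure) \<pi> (U :: int \<Rightarrow> 'w \<times> (int \<Rightarrow> real) \<Rightarrow> real).
        prob_space N \<and> \<pi> \<in> measurable N M \<and> distr N M \<pi> = M \<and>
        (\<forall>n. U n \<in> borel_measurable N) \<and>
        prob_space.indep_vars N (\<lambda>_. borel) U UNIV \<and>
        (\<forall>n. distr N borel (U n) = distr N borel (U 0)) \<and>
        immersed N (count_space UNIV) (\<lambda>n \<omega>. X n (\<pi> \<omega>)) borel U)"

end

theory Submission
  imports Defs
begin

text \<open>Write each letter as \<open>X\<^sub>n = F(past, U\<^sub>n)\<close> with \<open>F\<close> chosen so that two pasts
  \<open>x\<close>, \<open>y\<close> produce different letters with probability at most \<open>c \<parallel>p(\<cdot>|x) - p(\<cdot>|y)\<parallel>\<close>: \<open>c = 2\<close> by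
  rejection sampling, \<open>c = 1\<close> by a threshold when there are two letters. On an extension,
  \<open>U\<^sub>n\<close> is drawn from its conditional law given \<open>X\<close>, which makes the \<open>U\<^sub>n\<close> i.i.d. and
  independent of the earlier \<open>X\<close>.

  To see that \<open>X\<^sub>n\<close> is a function of \<open>(U\<^sub>k)\<^sub>k\<^sub>\<le>\<^sub>n\<close>, restart the recursion \<open>m\<close> steps
  earlier from an arbitrary past. The number of last letters on which the restarted process agrees
  with \<open>X\<close> dominates a chain that moves from \<open>l\<close> to \<open>l + 1\<close> with probability \<open>1 - c \<delta>\<^sub>l\<close> and
  otherwise falls back to \<open>0\<close>. Divergence of the series says that this chain is not positive
  recurrent, so the probability of sitting at \<open>0\<close> after \<open>m\<close> steps tends to \<open>0\<close>, and Borel-Cantelli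
  along a subsequence concludes.\<close>

section \<open>Encoding a sequence in a real number; the first accepted point\<close>

text \<open>The definition of standardness dictates the shape: the extension lives on
  \<open>'w \<times> (int \<Rightarrow> real)\<close> and the i.i.d. process is real-valued.
  Rejection consumes infinitely many uniforms at each time, so a whole sequence is packed measurably
  into one real. Rejection is used twice: to turn the source into a letter, and, on fresh auxiliary
  randomness, to draw the source conditioned on the letter already given by \<open>X\<close>. The
  constant 2 comes from laws at distance \<delta>: the first point below the larger of the two
  weights is also below the smaller one with probability (1 - \<delta>) / (1 + \<delta>), and the
  complement is at most 2 \<delta>. The vanishing of the probability of being at 0 needs no general
  renewal theorem: it decreases in the number of steps, so the renewal equation bounds it by the
  inverse of a partial sum of the series. Conditional independence does not use the series. Each
  \<open>U k\<close> depends on \<open>X\<close> only up to time \<open>k\<close> and on auxiliary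
  randomness independent of \<open>X\<close>, hence the source up to \<open>n\<close> tells nothing
  about the next letter beyond the past of \<open>X\<close>. The series serves only to put
  \<open>X n\<close> into the completed \<sigma>-field of the source.\<close>

definition seq_bit :: "(nat \<Rightarrow> real) \<Rightarrow> nat \<Rightarrow> bool" where
  "seq_bit t m \<longleftrightarrow> (case prod_decode m of (j, i) \<Rightarrow> of_rat (from_nat i) < t j)"

definition seq_encode :: "(nat \<Rightarrow> real) \<Rightarrow> real" where
  "seq_encode t = (\<Sum>m. of_bool (seq_bit t m) * (1/4)^m)"

text \<open>The code lists, as base-4 digits in \<open>{0, 1}\<close>, the rationals below each term of the sequence;
  the tail of such an expansion stays below one unit, so a digit is the parity of a floor.\<close>

definition seq_decode :: "real \<Rightarrow> nat \<Rightarrow> real" where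
  "seq_decode u j = real_of_ereal (SUP i. if odd \<lfloor>4 ^ prod_encode (j, i) * u\<rfloor>
     then ereal (of_rat (from_nat i)) else -\<infinity>)"

text \<open>Base 4 rules out carries: after scaling by \<open>4 ^ m\<close> the earlier digits
  contribute multiples of 4 and the later ones at most 1/3. In base 2 a tail of ones would reach a
  full unit.\<close>

lemma odd_floor_quaternary:
  fixes b :: "nat \<Rightarrow> bool"
  shows "odd \<lfloor>4 ^ m * (\<Sum>k. of_bool (b k) * (1/4::real) ^ k)\<rfloor> \<longleftrightarrow> b m"
proof -
  let ?g = "\<lambda>k. of_bool (b k) * (1/4::real) ^ k"
  have sg: "summable ?g"
    by (rule summable_comparison_test'[where g = "\<lambda>k. (1/4::real)^k" and N = 0]) auto
  define T where "T = (\<Sum>k. ?g (k + Suc m))"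
  have T0: "T \<ge> 0"
    unfolding T_def by (rule suminf_nonneg) (use sg summable_iff_shift[of ?g "Suc m"] in auto)
  have "T \<le> (\<Sum>k. (1/4::real)^(k + Suc m))"
    unfolding T_def
  proof (rule suminf_le)
    show "summable (\<lambda>k. ?g (k + Suc m))" using sg by (subst summable_iff_shift)
    show "summable (\<lambda>k. (1/4::real)^(k + Suc m))" by (subst summable_iff_shift) auto
  qed auto
  also have "\<dots> = (1/4) ^ Suc m * (\<Sum>k. (1/4::real)^k)"
    by (subst suminf_mult[symmetric]) (auto simp: power_add mult_ac)
  also have "(\<Sum>k. (1/4::real)^k) = 4/3" by (subst suminf_geometric) auto
  finally have T1: "T \<le> (1/4) ^ m / 3" by simp
  have split: "(\<Sum>k. ?g k) = T + (\<Sum>k<Suc m. ?g k)"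
    unfolding T_def by (rule suminf_split_initial_segment[OF sg])
  define z :: int where "z = (\<Sum>k<m. of_bool (b k) * 4 ^ (m - k))"
  have "4 ^ m * (\<Sum>k<m. ?g k) = real_of_int z"
    unfolding z_def sum_distrib_left of_int_sum
  proof (rule sum.cong)
    fix k assume "k \<in> {..<m}"
    hence "(4::real) ^ m = 4 ^ (m - k) * 4 ^ k" by (simp add: power_add[symmetric])
    thus "4 ^ m * (of_bool (b k) * (1/4::real) ^ k) = real_of_int (of_bool (b k) * 4 ^ (m - k))"
      by (simp add: power_one_over)
  qed simp
  hence "4 ^ m * (\<Sum>k. ?g k) = real_of_int (z + of_bool (b m)) + 4 ^ m * T"
    unfolding split by (simp add: algebra_simps power_one_over)
  moreover have "0 \<le> 4 ^ m * T" "4 ^ m * T < 1"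
    using T0 T1 by (auto simp: power_one_over field_simps intro: order.strict_trans1)
  ultimately have fl: "\<lfloor>4 ^ m * (\<Sum>k. ?g k)\<rfloor> = z + of_bool (b m)"
    by (intro floor_unique) auto
  have "even z"
    unfolding z_def by (rule dvd_sum) auto
  thus ?thesis unfolding fl by simp
qed

text \<open>A real is the supremum of the rationals below it. The value -\<infinity> makes the
  rationals that are not below it invisible to the supremum.\<close>

lemma seq_decode_encode: "seq_decode (seq_encode t) = t"
proof
  fix j
  have bit: "odd \<lfloor>4 ^ prod_encode (j, i) * seq_encode t\<rfloor> \<longleftrightarrow> of_rat (from_nat i) < t j" for i
    unfolding seq_encode_def odd_floor_quaternary by (simp add: seq_bit_def)
  have "(SUP i. if odd \<lfloor>4 ^ prod_encode (j, i) * seq_encode t\<rfloor>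
     then ereal (of_rat (from_nat i)) else -\<infinity>) = ereal (t j)"
  proof (rule SUP_eqI)
    fix y :: ereal
    assume y: "\<And>i. i \<in> UNIV \<Longrightarrow> (if odd \<lfloor>4 ^ prod_encode (j, i) * seq_encode t\<rfloor>
      then ereal (of_rat (from_nat i)) else -\<infinity>) \<le> y"
    show "ereal (t j) \<le> y"
    proof (rule dense_le)
      fix x assume "x < ereal (t j)"
      then obtain r where r: "x \<le> ereal r" "r < t j"
        using ereal_dense2[of x "ereal (t j)"] by (auto intro: less_imp_le)
      then obtain q where q: "r < of_rat q" "of_rat q < t j" using of_rat_dense by blast
      have "x \<le> ereal (of_rat q)" using r q by (metis ereal_less_eq(3) less_imp_le order_trans)
      also have "\<dots> \<le> y" using y[of "to_nat q"] q by (simp add: bit)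
      finally show "x \<le> y" .
    qed
  qed (auto simp: bit)
  thus "seq_decode (seq_encode t) j = t j" by (simp add: seq_decode_def)
qed

lemma measurable_seq_encode [measurable]:
  "seq_encode \<in> borel_measurable (PiM UNIV (\<lambda>_::nat. borel))"
  unfolding seq_encode_def seq_bit_def case_prod_beta by measurable

lemma measurable_seq_decode_nth [measurable]:
  "(\<lambda>u. seq_decode u j) \<in> borel_measurable borel"
  unfolding seq_decode_def by measurable

lemma measurable_seq_decode [measurable]:
  "seq_decode \<in> measurable borel (PiM UNIV (\<lambda>_::nat. borel))"
  by (rule measurable_PiM_single') (auto simp: )

section \<open>Rejection: the first accepted term of an i.i.d. sequence\<close>

definition first_in :: "('b \<Rightarrow> bool) \<Rightarrow> (nat \<Rightarrow> 'b) \<Rightarrow> 'b" where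
  "first_in P t = t (LEAST i. P (t i))"

lemma first_in:
  assumes "P (t i)" shows "P (first_in P t)"
  unfolding first_in_def using assms by (rule LeastI)

lemma first_in_eq:
  assumes "P (t i)" "\<And>j. j < i \<Longrightarrow> \<not> P (t j)" shows "first_in P t = t i"
  unfolding first_in_def using assms by (intro arg_cong[where f = t] Least_equality) (meson not_le)+

lemma first_in_ex:
  assumes "P (t i)" shows "\<exists>i. P (t i) \<and> (\<forall>j<i. \<not> P (t j)) \<and> first_in P t = t i"
  unfolding first_in_def using LeastI[of "\<lambda>i. P (t i)", OF assms] not_less_Least[of _ "\<lambda>i. P (t i)"] by blast

lemma measurable_first_in [measurable (raw)]:
  assumes [measurable]: "(\<lambda>(x, r). P x r) \<in> measurable (L \<Otimes>\<^sub>M N) (count_space UNIV)"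
    and [measurable]: "t \<in> measurable L (PiM UNIV (\<lambda>_::nat. N))"
  shows "(\<lambda>x. first_in (P x) (t x)) \<in> measurable L N"
proof -
  have [measurable]: "(\<lambda>x. t x i) \<in> measurable L N" for i by measurable
  have [measurable]: "Measurable.pred L (\<lambda>x. P x (t x i))" for i
    using measurable_compose[OF _ assms(1), of "\<lambda>x. (x, t x i)" L] by simp
  show ?thesis unfolding first_in_def
    by (rule measurable_compose_countable[where f = "\<lambda>i x. t x i"]) measurable
qed

context prob_space
begin

text \<open>Splitting by the index \<open>i\<close> of the first accepted term gives
  \<open>(1 - s) ^ i\<close> times the probability of being accepted and satisfying
  \<open>Q\<close>. The geometric series then produces the conditional probability.\<close>

lemma first_in_law:
  assumes [measurable]: "Measurable.pred M P" "Measurable.pred M Q"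
    and pos: "prob {r \<in> space M. P r} > 0"
  shows "AE t in PiM UNIV (\<lambda>_::nat. M). \<exists>i. P (t i)"
    and "measure (PiM UNIV (\<lambda>_::nat. M)) {t \<in> space (PiM UNIV (\<lambda>_::nat. M)). Q (first_in P t)} =
      prob {r \<in> space M. P r \<and> Q r} / prob {r \<in> space M. P r}"
proof -
  let ?S = "PiM UNIV (\<lambda>_::nat. M)"
  interpret S: prob_space ?S by (rule prob_space_PiM) (rule prob_space_axioms)
  interpret seq: product_prob_space "\<lambda>_::nat. M" UNIV ..
  define s where "s = prob {r \<in> space M. P r}"
  have s1: "s \<le> 1" "s > 0" using pos by (auto simp: s_def)
  have spS: "t i \<in> space M" if "t \<in> space ?S" for t i using that by (auto simp: space_PiM)
  define E where "E Q i = {t \<in> space ?S. (\<forall>j<i. \<not> P (t j)) \<and> P (t i) \<and> Q (t i)}" for Q and i::nat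
  have E: "(\<lambda>i. measure ?S (E Q i)) sums (prob {r \<in> space M. P r \<and> Q r} / s)"
    if [measurable]: "Measurable.pred M Q" for Q
  proof -
    have "measure ?S (E Q i) = (1 - s) ^ i * prob {r \<in> space M. P r \<and> Q r}" for i
    proof -
      let ?A = "\<lambda>j. if j < i then {r \<in> space M. \<not> P r} else {r \<in> space M. P r \<and> Q r}"
      have "E Q i = {t \<in> space ?S. \<forall>j\<in>{..i}. t j \<in> ?A j}"
        unfolding E_def using spS by (auto simp: le_less)
      hence "measure ?S (E Q i) = (\<Prod>j\<in>{..i}. prob (?A j))"
        using seq.emeasure_PiM_Collect[of "{..i}" ?A]
        by (simp add: S.emeasure_eq_measure emeasure_eq_measure prod_ennreal prod_nonneg)
      also have "\<dots> = (\<Prod>j<i. prob {r \<in> space M. \<not> P r}) * prob {r \<in> space M. P r \<and> Q r}"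
        by (simp add: lessThan_Suc_atMost[symmetric])
      also have "prob {r \<in> space M. \<not> P r} = 1 - s"
        unfolding s_def by (rule prob_neg) measurable
      finally show ?thesis by simp
    qed
    moreover have "(\<lambda>i. (1 - s) ^ i * prob {r \<in> space M. P r \<and> Q r}) sums
        (1 / (1 - (1 - s)) * prob {r \<in> space M. P r \<and> Q r})"
      by (intro sums_mult2 geometric_sums) (use s1 in auto)
    ultimately show ?thesis by simp
  qed
  have mE: "range (E Q) \<subseteq> sets ?S" if [measurable]: "Measurable.pred M Q" for Q
    unfolding E_def by auto
  have disj: "disjoint_family (E Q)" for Q
    unfolding disjoint_family_on_def E_def by (auto, metis linorder_neqE_nat)
  have U: "measure ?S (\<Union>i. E Q i) = prob {r \<in> space M. P r \<and> Q r} / s"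
    if "Measurable.pred M Q" for Q
    using S.finite_measure_UNION[OF mE[OF that] disj] E[OF that] by (rule sums_unique2)
  \<comment> \<open>With \<open>Q\<close> always true the total mass is \<open>s / s\<close>, so
    almost surely some term is accepted.\<close>
  have "measure ?S (\<Union>i. E (\<lambda>_. True) i) = 1"
    using U[of "\<lambda>_. True"] s1 by (simp add: s_def)
  hence "AE t in ?S. t \<in> (\<Union>i. E (\<lambda>_. True) i)"
    using mE[of "\<lambda>_. True"] by (subst S.prob_eq_1[symmetric]) auto
  thus AE: "AE t in ?S. \<exists>i. P (t i)" by eventually_elim (auto simp: E_def)
  have [measurable]: "Measurable.pred ?S (\<lambda>t. Q (first_in P t))"
    by measurable
  have "measure ?S {t \<in> space ?S. Q (first_in P t)} = measure ?S (\<Union>i. E Q i)"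
  proof (rule S.finite_measure_eq_AE)
    show "AE t in ?S. (t \<in> {t \<in> space ?S. Q (first_in P t)}) = (t \<in> (\<Union>i. E Q i))"
      using AE
    proof eventually_elim
      case (elim t)
      then obtain i where i: "P (t i)" "\<forall>j<i. \<not> P (t j)" "first_in P t = t i"
        using first_in_ex[of P t] by blast
      have uniq: "k = i" if "t \<in> E Q k" for k
        using that i(1,2) unfolding E_def by (metis (mono_tags, lifting) linorder_neqE_nat mem_Collect_eq)
      have "t \<in> (\<Union>k. E Q k) \<longleftrightarrow> t \<in> E Q i" using uniq by blast
      also have "\<dots> \<longleftrightarrow> t \<in> space ?S \<and> Q (first_in P t)" using i unfolding E_def by simp
      finally show ?case by simp
    qed
  qed (use mE[of Q] in auto)
  thus "measure ?S {t \<in> space ?S. Q (first_in P t)} =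
      prob {r \<in> space M. P r \<and> Q r} / prob {r \<in> space M. P r}"
    using U[of Q] by (simp add: s_def)
qed

end

section \<open>Sampling a letter from a uniform source\<close>

text \<open>The source law is left abstract because the two cases use different ones: uniform on [0,
  1) for a threshold, the law of an encoded i.i.d. sequence for rejection. Only \<open>c\<close> in
  \<open>sample_gap\<close> distinguishes the two cases later on.\<close>

locale sampler = prob_space \<mu> for \<mu> :: "real measure" +
  fixes p :: "(nat \<Rightarrow> 'a::finite) \<Rightarrow> 'a \<Rightarrow> real" and c :: real and F :: "(nat \<Rightarrow> 'a) \<Rightarrow> real \<Rightarrow> 'a"
  assumes sets_law [measurable_cong]: "sets \<mu> = sets borel"
    and measurable_sample [measurable]: "(\<lambda>(x, u). F x u) \<in> measurable (past_space \<Otimes>\<^sub>M borel) (count_space UNIV)"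
    and sample_law: "prob {u. F x u = a} = p x a"
    and sample_gap: "prob {u. F x u \<noteq> F y u} \<le> c * tv_dist (p x) (p y)"

text \<open>A single threshold \<open>p x a0\<close> decides the letter. Two pasts disagree exactly
  when the uniform point falls between their thresholds, and with two letters the gap between the
  thresholds is the total variation distance.\<close>

lemma ex_sampler_binary:
  fixes p :: "(nat \<Rightarrow> 'a::finite) \<Rightarrow> 'a \<Rightarrow> real"
  assumes card: "CARD('a) = 2" and nonneg: "\<And>x a. 0 \<le> p x a" and sum1: "\<And>x. (\<Sum>a\<in>UNIV. p x a) = 1"
    and [measurable]: "\<And>a. (\<lambda>x. p x a) \<in> borel_measurable past_space"
  shows "\<exists>\<mu> F. sampler \<mu> p 1 F"
proof -
  obtain a0 a1 :: 'a where a: "UNIV = {a0, a1}" "a0 \<noteq> a1" using card by (auto simp: card_2_iff)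
  have p1: "p x a1 = 1 - p x a0" for x using sum1[of x] a(2) unfolding a(1) by simp
  have le1: "p x a0 \<le> 1" for x using nonneg[of x a1] p1[of x] by simp
  define \<mu> where "\<mu> = uniform_measure lborel {0..<1::real}"
  define F where "F x u = (if u < p x a0 then a0 else a1)" for x u
  interpret prob_space \<mu> unfolding \<mu>_def by (rule prob_space_uniform_measure) auto
  have m: "prob A = measure lborel ({0..<1} \<inter> A)" if "A \<in> sets borel" for A
    unfolding \<mu>_def using that by (subst measure_uniform_measure) auto
  have "sampler \<mu> p 1 F"
  proof
    show "sets \<mu> = sets borel" by (simp add: \<mu>_def)
    show "(\<lambda>(x, u). F x u) \<in> measurable (past_space \<Otimes>\<^sub>M borel) (count_space UNIV)"
      unfolding F_def by measurable
    fix x :: "nat \<Rightarrow> 'a" and a :: 'a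
    have "{0..<1} \<inter> {u. F x u = a0} = {0..<p x a0}" using a le1[of x] by (auto simp: F_def)
    moreover have "{0..<1} \<inter> {u. F x u = a1} = {p x a0..<1}"
      using a nonneg[of x a0] by (auto simp: F_def split: if_splits)
    moreover have "{u. F x u = a} \<in> sets borel" by (simp add: F_def)
    moreover have "a = a0 \<or> a = a1" using a by auto
    ultimately show "prob {u. F x u = a} = p x a"
      using nonneg[of x] le1[of x] p1[of x] by (auto simp: m)
  next
    fix x y :: "nat \<Rightarrow> 'a"
    have "{0..<1} \<inter> {u. F x u \<noteq> F y u} = {min (p x a0) (p y a0)..<max (p x a0) (p y a0)}"
      using a le1[of x] le1[of y] nonneg[of x a0] nonneg[of y a0] by (auto simp: F_def split: if_splits)
    moreover have "{u. F x u \<noteq> F y u} \<in> sets borel" unfolding F_def by measurable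
    moreover have "tv_dist (p x) (p y) = \<bar>p x a0 - p y a0\<bar>"
      using a(2) unfolding tv_dist_def a(1) by (simp add: p1)
    ultimately show "prob {u. F x u \<noteq> F y u} \<le> 1 * tv_dist (p x) (p y)"
      by (auto simp: m min_def max_def)
  qed
  thus ?thesis by blast
qed

text \<open>Rejection sampling: the points of an i.i.d. uniform sequence in \<open>[0, card A)\<close> are the pairs
  of a letter (the integer part) and a threshold (the fractional part); the sample is the letter of
  the first point whose threshold is below its probability. Two laws give the same sample as soon as
  the first point accepted by one of them is accepted by both.\<close>

lemma ex_sampler_finite:
  fixes p :: "(nat \<Rightarrow> 'a::finite) \<Rightarrow> 'a \<Rightarrow> real"
  assumes nonneg: "\<And>x a. 0 \<le> p x a" and sum1: "\<And>x. (\<Sum>a\<in>UNIV. p x a) = 1"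
    and [measurable]: "\<And>a. (\<lambda>x. p x a) \<in> borel_measurable past_space"
  shows "\<exists>\<mu> F. sampler \<mu> p 2 F"
proof -
  define K where "K = CARD('a)"
  have K: "K > 0" by (simp add: K_def)
  obtain e where e: "bij_betw e {..<K} (UNIV :: 'a set)"
    using ex_bij_betw_nat_finite[of "UNIV :: 'a set"] by (auto simp: K_def atLeast0LessThan)
  have le1: "p x a \<le> 1" for x a
    using member_le_sum[of a UNIV "p x"] nonneg sum1[of x] by auto
  define \<rho> where "\<rho> = uniform_measure lborel {0..<real K}"
  interpret R: prob_space \<rho> unfolding \<rho>_def by (rule prob_space_uniform_measure) (use K in auto)
  have sets_rho [measurable_cong, simp]: "sets \<rho> = sets borel" by (simp add: \<rho>_def)
  have [simp]: "space \<rho> = UNIV" by (simp add: \<rho>_def)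
  define letter where "letter r = e (nat \<lfloor>r\<rfloor>)" for r :: real
  define accept where "accept h r \<longleftrightarrow> r - \<lfloor>r\<rfloor> < h (letter r)" for h :: "'a \<Rightarrow> real" and r :: real
  have [measurable]: "letter \<in> measurable borel (count_space UNIV)"
    unfolding letter_def by measurable
  have [measurable]: "(\<lambda>z. p (f z) (letter (g z))) \<in> borel_measurable L"
    if [measurable]: "f \<in> measurable L past_space" "g \<in> borel_measurable L" for f g and L :: "'z measure"
    by (rule measurable_compose_countable[where f = "\<lambda>a z. p (f z) a"]) measurable
  have [measurable]: "(\<lambda>r::real. real_of_int \<lfloor>r\<rfloor>) \<in> borel_measurable borel"
    by (rule measurable_compose[OF measurable_real_floor]) simp
  have acc_p [measurable]: "Measurable.pred L (\<lambda>z. accept (p (f z)) (g z))"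
    if [measurable]: "f \<in> measurable L past_space" "g \<in> borel_measurable L" for f g and L :: "'z measure"
    unfolding accept_def by measurable
  have acc_m [measurable]: "Measurable.pred borel (accept h)" for h
  proof -
    have [measurable]: "(\<lambda>r. h (letter r)) \<in> borel_measurable borel"
      by (rule measurable_compose[where f = letter and N = "count_space UNIV"]) simp_all
    show ?thesis unfolding accept_def by measurable
  qed
  \<comment> \<open>On [0, K) the acceptance region is one interval of length \<open>h (e k)\<close>
    above each integer \<open>k\<close>; since \<open>h\<close> is at most 1 these intervals are
    disjoint.\<close>
  have vol: "R.prob {r. accept h r} = (\<Sum>a\<in>UNIV. h a) / K" if h: "\<And>a. 0 \<le> h a" "\<And>a. h a \<le> 1" for h
  proof -
    have "{0..<real K} \<inter> {r. accept h r} = (\<Union>k<K. {real k..<k + h (e k)})" (is "?L = ?R")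
    proof (intro equalityI subsetI)
      fix r assume r: "r \<in> ?L"
      hence "nat \<lfloor>r\<rfloor> < K" "real (nat \<lfloor>r\<rfloor>) \<le> r" by (auto simp: nat_less_iff floor_less_iff)
      thus "r \<in> ?R" using r by (auto simp: accept_def letter_def intro!: bexI[of _ "nat \<lfloor>r\<rfloor>"])
    next
      fix r assume "r \<in> ?R"
      then obtain k where k: "k < K" "real k \<le> r" "r < k + h (e k)" by auto
      hence "\<lfloor>r\<rfloor> = int k" using h(2)[of "e k"] by (intro floor_unique) auto
      moreover have "real k + 1 \<le> real K" using k by linarith
      ultimately show "r \<in> ?L" using k h(2)[of "e k"] by (auto simp: accept_def letter_def)
    qed
    moreover have "emeasure lborel (\<Union>k<K. {real k..<k + h (e k)}) = (\<Sum>k<K. emeasure lborel {real k..<k + h (e k)})"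
    proof (rule sum_emeasure[symmetric])
      have "i = j" if "real i \<le> r" "r < i + h (e i)" "real j \<le> r" "r < j + h (e j)" for i j r
        using that h(2)[of "e i"] h(2)[of "e j"] by linarith
      thus "disjoint_family_on (\<lambda>k. {real k..<k + h (e k)}) {..<K}"
        unfolding disjoint_family_on_def by fastforce
    qed auto
    moreover have "(\<Sum>k<K. emeasure lborel {real k..<k + h (e k)}) = ennreal (\<Sum>k<K. h (e k))"
      using h by (simp add: sum_ennreal)
    moreover have "(\<Sum>k<K. h (e k)) = (\<Sum>a\<in>UNIV. h a)"
      by (rule sum.reindex_bij_betw[OF e])
    ultimately have "emeasure \<rho> {r. accept h r} = ennreal (\<Sum>a\<in>UNIV. h a) / ennreal K"
      unfolding \<rho>_def by (subst emeasure_uniform_measure) auto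
    thus ?thesis using K h by (simp add: R.emeasure_eq_measure divide_ennreal sum_nonneg)
  qed
  have min1: "min (p x a) (p y a) \<le> 1" "max (p x a) (p y a) \<le> 1" for x y a
    using le1[of x a] le1[of y a] by auto
  have vp: "R.prob {r. accept (p x) r} = 1 / K" for x
    using vol[of "p x"] nonneg le1 sum1 by simp
  define \<mu> where "\<mu> = distr (PiM UNIV (\<lambda>_::nat. \<rho>)) borel seq_encode"
  define F where "F x u = letter (first_in (accept (p x)) (seq_decode u))" for x u
  let ?S = "PiM UNIV (\<lambda>_::nat. \<rho>)"
  interpret S: prob_space ?S by (rule prob_space_PiM) unfold_locales
  have sets_S: "sets ?S = sets (PiM UNIV (\<lambda>_::nat. borel))" by (intro sets_PiM_cong) auto
  note [measurable_cong] = sets_S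
  have [simp]: "space ?S = UNIV" by (simp add: space_PiM)
  have enc [measurable]: "seq_encode \<in> measurable ?S borel" by measurable
  interpret prob_space \<mu> unfolding \<mu>_def by (rule S.prob_space_distr) measurable
  have Fm [measurable]: "(\<lambda>(x, u). F x u) \<in> measurable (past_space \<Otimes>\<^sub>M borel) (count_space UNIV)"
    unfolding F_def by measurable
  have [measurable]: "F x \<in> measurable borel (count_space UNIV)" for x
    using measurable_Pair2[OF Fm, of x] by (simp add: past_space_def space_PiM)
  have "sampler \<mu> p 2 F"
  proof
    show "sets \<mu> = sets borel" by (simp add: \<mu>_def)
    fix x :: "nat \<Rightarrow> 'a" and a :: 'a
    \<comment> \<open>Accepting with letter \<open>a\<close> is acceptance for the weight function
      cut down to \<open>a\<close>: a fractional part is nonnegative, so weight 0 accepts nothing.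
      Thus \<open>vol\<close> applies once more.\<close>
    have eq: "{r. accept (p x) r \<and> letter r = a} = {r. accept (\<lambda>b. if b = a then p x a else 0) r}"
    proof (rule Collect_cong)
      fix r :: real
      have "real_of_int \<lfloor>r\<rfloor> \<le> r" by (rule of_int_floor_le)
      thus "accept (p x) r \<and> letter r = a \<longleftrightarrow> accept (\<lambda>b. if b = a then p x a else 0) r"
        by (auto simp: accept_def simp del: of_int_floor_le split: if_splits)
    qed
    have va: "R.prob {r. accept (p x) r \<and> letter r = a} = p x a / K"
      unfolding eq by (subst vol) (simp_all add: nonneg le1)
    have "prob {u. F x u = a} = S.prob {t. letter (first_in (accept (p x)) t) = a}"
      unfolding \<mu>_def by (subst measure_distr) (auto simp: F_def seq_decode_encode)
    also have "\<dots> = R.prob {r. accept (p x) r \<and> letter r = a} / R.prob {r. accept (p x) r}"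
      using R.first_in_law(2)[of "accept (p x)" "\<lambda>r. letter r = a"] K by (simp add: vp)
    finally show "prob {u. F x u = a} = p x a" using K by (simp add: vp va)
  next
    fix x y :: "nat \<Rightarrow> 'a"
    \<comment> \<open>The pointwise minimum and maximum of the two laws have masses 1 - \<delta> and
      1 + \<delta>.\<close>
    let ?m = "\<lambda>a. min (p x a) (p y a)" and ?M = "\<lambda>a. max (p x a) (p y a)"
    define \<delta> where "\<delta> = tv_dist (p x) (p y)"
    have abs: "\<bar>p x a - p y a\<bar> = p x a + p y a - 2 * ?m a" "\<bar>p x a - p y a\<bar> = 2 * ?M a - p x a - p y a" for a
      by (auto simp: min_def max_def)
    have sm: "(\<Sum>a\<in>UNIV. ?m a) = 1 - \<delta>"
    proof -
      have "(\<Sum>a\<in>UNIV. \<bar>p x a - p y a\<bar>) = 1 + 1 - 2 * (\<Sum>a\<in>UNIV. ?m a)"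
        unfolding abs(1) sum_subtractf sum.distrib sum_distrib_left sum1 ..
      thus ?thesis unfolding \<delta>_def tv_dist_def by linarith
    qed
    have sM: "(\<Sum>a\<in>UNIV. ?M a) = 1 + \<delta>"
    proof -
      have "(\<Sum>a\<in>UNIV. \<bar>p x a - p y a\<bar>) = 2 * (\<Sum>a\<in>UNIV. ?M a) - 1 - 1"
        unfolding abs(2) sum_subtractf sum_distrib_left sum1 ..
      thus ?thesis unfolding \<delta>_def tv_dist_def by linarith
    qed
    have \<delta>0: "\<delta> \<ge> 0" unfolding \<delta>_def tv_dist_def by (simp add: sum_nonneg)
    have vM: "R.prob {r. accept ?M r} = (1 + \<delta>) / K"
      using nonneg min1 by (subst vol) (auto simp: sM le_max_iff_disj)
    have vm: "R.prob {r. accept ?M r \<and> accept ?m r} = (1 - \<delta>) / K"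
    proof -
      have "{r. accept ?M r \<and> accept ?m r} = {r. accept ?m r}" by (auto simp: accept_def)
      thus ?thesis using nonneg min1 by (simp add: vol sm)
    qed
    have "Measurable.pred ?S (\<lambda>t. accept ?m (first_in (accept ?M) t))" by measurable
    hence ms: "{t. accept ?m (first_in (accept ?M) t)} \<in> S.events" by (simp add: pred_def)
    have "prob {u. F x u \<noteq> F y u} =
        S.prob {t. letter (first_in (accept (p x)) t) \<noteq> letter (first_in (accept (p y)) t)}"
      unfolding \<mu>_def by (subst measure_distr) (auto simp: F_def seq_decode_encode)
    also have "\<dots> \<le> S.prob {t. \<not> accept ?m (first_in (accept ?M) t)}"
    proof (rule S.finite_measure_mono_AE)
      have "Measurable.pred ?S (\<lambda>t. \<not> accept ?m (first_in (accept ?M) t))" by measurable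
      thus "{t. \<not> accept ?m (first_in (accept ?M) t)} \<in> S.events" by (simp add: pred_def)
      have "AE t in ?S. \<exists>i. accept ?M (t i)"
        using R.first_in_law(1)[of "accept ?M" "\<lambda>_. True"] K \<delta>0 by (simp add: vM)
      thus "AE t in ?S. t \<in> {t. letter (first_in (accept (p x)) t) \<noteq> letter (first_in (accept (p y)) t)}
          \<longrightarrow> t \<in> {t. \<not> accept ?m (first_in (accept ?M) t)}"
      proof eventually_elim
        case (elim t)
        then obtain i where i: "accept ?M (t i)" "\<forall>j<i. \<not> accept ?M (t j)" "first_in (accept ?M) t = t i"
          using first_in_ex[of "accept ?M" t] by blast
        \<comment> \<open>Every term before \<open>i\<close> exceeds the maximum, so neither law
          accepts it; a term below the minimum is accepted by both. Hence both stop at the same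
          point and read the same letter.\<close>
        have "first_in (accept (p x)) t = t i" "first_in (accept (p y)) t = t i" if "accept ?m (t i)"
          using that i(2) by (auto intro!: first_in_eq simp: accept_def)
        thus ?case using i by auto
      qed
    qed
    also have "\<dots> = 1 - S.prob {t. accept ?m (first_in (accept ?M) t)}"
      using ms
      using S.prob_neg[of "\<lambda>t. accept ?m (first_in (accept ?M) t)"] by simp
    also have "\<dots> = 1 - (1 - \<delta>) / (1 + \<delta>)"
      using R.first_in_law(2)[of "accept ?M" "accept ?m"] K \<delta>0 by (simp add: vM vm)
    \<comment> \<open>The exact value is 2 \<delta> / (1 + \<delta>); dropping the denominator gives
      the constant 2.\<close>
    also have "\<dots> \<le> 2 * \<delta>"
    proof -
      have "1 - (1 - \<delta>) / (1 + \<delta>) = 2 * \<delta> / (1 + \<delta>)" using \<delta>0 by (simp add: field_simps)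
      also have "\<dots> \<le> 2 * \<delta> / 1" using \<delta>0 by (intro divide_left_mono) auto
      finally show ?thesis by simp
    qed
    finally show "prob {u. F x u \<noteq> F y u} \<le> 2 * tv_dist (p x) (p y)" by (simp add: \<delta>_def)
  qed measurable
  thus ?thesis by blast
qed

section \<open>The comparison chain and its renewal equation\<close>

text \<open>\<open>hit r m l\<close> is the probability that the chain which moves from \<open>k\<close> to \<open>k + 1\<close> with
  probability \<open>r k\<close>, and to \<open>0\<close> otherwise, is at \<open>0\<close> after \<open>m\<close> steps from \<open>l\<close>.\<close>

primrec hit :: "(nat \<Rightarrow> real) \<Rightarrow> nat \<Rightarrow> nat \<Rightarrow> real" where
  "hit r 0 l = of_bool (l = 0)"
| "hit r (Suc m) l = r l * hit r m (Suc l) + (1 - r l) * hit r m 0"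

context
  fixes r :: "nat \<Rightarrow> real"
  assumes r01: "\<And>l. 0 \<le> r l" "\<And>l. r l \<le> 1" and r_mono: "incseq r"
begin

lemma hit_nonneg: "0 \<le> hit r m l"
  by (induction m arbitrary: l) (use r01 in auto)

text \<open>One step from \<open>l\<close> yields
  \<open>hit r m 0 - r l * (hit r m 0 - hit r m (Suc l))\<close>. Raising \<open>l\<close> increases
  both factors of the subtracted product, the first because \<open>r\<close> increases and the
  second by induction.\<close>

lemma hit_antimono_start: "hit r m (Suc l) \<le> hit r m l"
proof (induction m arbitrary: l)
  case (Suc m)
  have le0: "hit r m k \<le> hit r m 0" for k
    by (induction k) (use Suc order_trans in auto)
  have "hit r (Suc m) (Suc l) \<le> r (Suc l) * hit r m (Suc l) + (1 - r (Suc l)) * hit r m 0"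
    using Suc[of "Suc l"] r01 by (simp add: mult_left_mono)
  also have "\<dots> = hit r m 0 - r (Suc l) * (hit r m 0 - hit r m (Suc l))"
    by (simp add: algebra_simps)
  also have "\<dots> \<le> hit r m 0 - r l * (hit r m 0 - hit r m (Suc l))"
    using le0[of "Suc l"] incseqD[OF r_mono, of l "Suc l"] by (simp add: mult_right_mono)
  also have "\<dots> = hit r (Suc m) l" by (simp add: algebra_simps)
  finally show ?case .
qed auto

lemma hit_antimono: "hit r m l \<le> hit r m 0"
  by (induction l) (use hit_antimono_start order_trans in blast)+

text \<open>The first step from 0 leads to 1 or back to 0, and no start makes a visit to 0 likelier
  than 0 itself.\<close>

lemma hit_decreasing: "hit r (Suc m) 0 \<le> hit r m 0"
  using mult_left_mono[OF hit_antimono[of m 1] r01(1)[of 0]] by (simp add: algebra_simps)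

text \<open>The survival probabilities \<open>R k\<close> satisfy a renewal equation with \<open>hit r m 0\<close>.\<close>

lemma hit_renewal: "(\<Sum>k\<le>m. (\<Prod>l<k. r l) * hit r (m - k) 0) = 1"
proof (induction m)
  case (Suc m)
  let ?R = "\<lambda>k. \<Prod>l<k. r l"
  \<comment> \<open>Decomposition by the first fall within \<open>j\<close> steps:
    \<open>?R j\<close> is the probability of climbing straight to \<open>j\<close>, and
    \<open>?R k - ?R (Suc k)\<close> that of falling at step \<open>k + 1\<close>, which leaves
    \<open>m - k\<close> steps from 0.\<close>
  have unroll: "hit r (Suc m) 0 = ?R j * hit r (Suc m - j) j + (\<Sum>k<j. (?R k - ?R (Suc k)) * hit r (m - k) 0)"
    if "j \<le> Suc m" for j using that
  proof (induction j)
    case (Suc j)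
    have eq: "hit r (Suc m - j) j = r j * hit r (m - j) (Suc j) + (1 - r j) * hit r (m - j) 0"
      using Suc.prems by (simp add: Suc_diff_le)
    have "?R j * hit r (Suc m - j) j =
        ?R (Suc j) * hit r (m - j) (Suc j) + (?R j - ?R (Suc j)) * hit r (m - j) 0"
      unfolding eq by (simp add: algebra_simps)
    thus ?case using Suc by simp
  qed simp
  \<comment> \<open>For \<open>j = Suc m\<close> no step is left at level \<open>Suc m\<close>, so
    the unbroken climb contributes 0.\<close>
  have "hit r (Suc m) 0 = (\<Sum>k\<le>m. (?R k - ?R (Suc k)) * hit r (m - k) 0)"
    using unroll[of "Suc m"] by (simp add: lessThan_Suc_atMost)
  also have "\<dots> = 1 - (\<Sum>k\<le>m. ?R (Suc k) * hit r (m - k) 0)"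
    using Suc by (simp add: left_diff_distrib sum_subtractf)
  finally show ?case by (simp add: sum.atMost_Suc_shift del: hit.simps sum.atMost_Suc)
qed simp

text \<open>As \<open>hit r m 0\<close> decreases in \<open>m\<close>, its last value may replace
  all the others in the renewal equation, so it times the sum of the survival probabilities is at
  most 1. The term of index 0 is dropped, which turns the products over \<open>l < k\<close> into
  those over \<open>n \<le> k\<close> of the hypothesis.\<close>

lemma hit_tendsto_zero:
  assumes div: "filterlim (\<lambda>K. \<Sum>k\<le>K. \<Prod>n\<le>k. r n) at_top sequentially"
  shows "(\<lambda>m. hit r m 0) \<longlonglongrightarrow> 0"
proof -
  have dec: "decseq (\<lambda>m. hit r m 0)" by (rule decseq_SucI) (rule hit_decreasing)
  have bound: "hit r (Suc m) 0 * (\<Sum>k\<le>m. \<Prod>n\<le>k. r n) \<le> 1" for m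
  proof -
    have "hit r (Suc m) 0 * (\<Sum>k\<le>m. \<Prod>n\<le>k. r n) \<le> (\<Sum>k\<le>Suc m. (\<Prod>l<k. r l) * hit r (Suc m) 0)"
      using hit_nonneg[of "Suc m" 0]
      by (simp add: sum.atMost_Suc_shift lessThan_Suc_atMost sum_distrib_left mult_ac
          del: hit.simps sum.atMost_Suc)
    also have "\<dots> \<le> (\<Sum>k\<le>Suc m. (\<Prod>l<k. r l) * hit r (Suc m - k) 0)"
      by (intro sum_mono mult_left_mono decseqD[OF dec] prod_nonneg) (use r01 in auto)
    finally show ?thesis by (simp only: hit_renewal)
  qed
  have "(\<lambda>m. hit r (Suc m) 0) \<longlonglongrightarrow> 0"
  proof (rule tendsto_sandwich[of "\<lambda>_. 0" _ _ "\<lambda>m. inverse (\<Sum>k\<le>m. \<Prod>n\<le>k. r n)"])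
    show "(\<lambda>m. inverse (\<Sum>k\<le>m. \<Prod>n\<le>k. r n)) \<longlonglongrightarrow> 0"
      using tendsto_inverse_0_at_top[OF div] .
    show "\<forall>\<^sub>F m in sequentially. hit r (Suc m) 0 \<le> inverse (\<Sum>k\<le>m. \<Prod>n\<le>k. r n)"
      using filterlim_at_top_dense[THEN iffD1, OF div, rule_format, of 0]
      by eventually_elim (use bound in \<open>simp add: field_simps\<close>)
  qed (use hit_nonneg in \<open>auto simp del: hit.simps\<close>)
  thus ?thesis by (rule LIMSEQ_imp_Suc)
qed

end

section \<open>Coupling two pasts through a common source\<close>

text \<open>Index 0 carries the most recent letter, so an appended word of length \<open>n\<close>
  occupies, reversed, the first \<open>n\<close> positions. This turns \<open>delta p n\<close> into
  a supremum over pasts agreeing on their last \<open>n\<close> letters.\<close>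

lemma past_concat_agree:
  "(\<exists>x y z. x' = past_concat x z \<and> y' = past_concat y z \<and> length z = n) \<longleftrightarrow> (\<forall>i<n. x' i = y' i)"
proof (intro iffI)
  assume agree: "\<forall>i<n. x' i = y' i"
  define z where "z = rev (map x' [0..<n])"
  have "x' = past_concat (\<lambda>m. x' (m + n)) z" "y' = past_concat (\<lambda>m. y' (m + n)) z"
    using agree by (auto simp: past_concat_def z_def)
  moreover have "length z = n" by (simp add: z_def)
  ultimately show "\<exists>x y z. x' = past_concat x z \<and> y' = past_concat y z \<and> length z = n" by blast
qed (auto simp: past_concat_def)

lemma delta_eq_Sup_agree: "delta p n = Sup {tv_dist (p x) (p y) | x y. \<forall>i<n. x i = y i}"
proof -
  have "{tv_dist (p (past_concat x z)) (p (past_concat y z)) | x y z. length z = n} =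
      {tv_dist (p x') (p y') | x' y'. \<exists>x y z. x' = past_concat x z \<and> y' = past_concat y z \<and> length z = n}"
    by blast
  thus ?thesis unfolding delta_def past_concat_agree by simp
qed

locale cond_law =
  fixes p :: "(nat \<Rightarrow> 'a::finite) \<Rightarrow> 'a \<Rightarrow> real"
  assumes nonneg: "0 \<le> p x a" and sum1: "(\<Sum>a\<in>UNIV. p x a) = 1"
    and measurable_law [measurable]: "(\<lambda>x. p x a) \<in> borel_measurable past_space"
begin

lemma tv_dist_le_1: "tv_dist (p x) (p y) \<le> 1"
proof -
  have "(\<Sum>a\<in>UNIV. \<bar>p x a - p y a\<bar>) \<le> (\<Sum>a\<in>UNIV. p x a + p y a)"
    by (intro sum_mono) (use nonneg in \<open>auto simp: abs_le_iff add_increasing add_increasing2\<close>)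
  also have "\<dots> = 2" by (simp add: sum.distrib sum1)
  finally show ?thesis by (simp add: tv_dist_def)
qed

lemma bdd_tv_dist: "bdd_above {tv_dist (p x) (p y) | x y. \<forall>i<n. x i = y i}"
  using tv_dist_le_1 by (auto simp: bdd_above_def intro!: exI[of _ 1])

lemma tv_dist_le_delta: "(\<And>i. i < n \<Longrightarrow> x i = y i) \<Longrightarrow> tv_dist (p x) (p y) \<le> delta p n"
  unfolding delta_eq_Sup_agree by (rule cSup_upper[OF _ bdd_tv_dist]) auto

lemma decseq_delta: "decseq (delta p)"
proof (rule decseq_SucI)
  show "delta p (Suc n) \<le> delta p n" for n
    unfolding delta_eq_Sup_agree by (rule cSup_subset_mono[OF _ bdd_tv_dist]) (use less_SucI in blast)+
qed

lemma delta_le_1: "delta p n \<le> 1"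
  unfolding delta_eq_Sup_agree by (rule cSup_least) (use tv_dist_le_1 in auto)

lemma delta_nonneg: "0 \<le> delta p n"
  using tv_dist_le_delta[of n undefined undefined] by (simp add: tv_dist_def)

end

text \<open>The state is the whole past, newest letter at index 0, so the last letter produced is
  read at 0. The oldest step is driven by \<open>u 0\<close>.\<close>

primrec run :: "((nat \<Rightarrow> 'a) \<Rightarrow> real \<Rightarrow> 'a) \<Rightarrow> nat \<Rightarrow> (nat \<Rightarrow> 'a) \<Rightarrow> (nat \<Rightarrow> real) \<Rightarrow> nat \<Rightarrow> 'a" where
  "run F 0 x u = x"
| "run F (Suc m) x u = run F m (case_nat (F x (u 0)) x) (\<lambda>i. u (Suc i))"

lemma space_past_space [simp]: "space past_space = UNIV"
  by (simp add: past_space_def space_PiM)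

lemma measurable_past_nth [measurable (raw)]:
  assumes "f \<in> measurable L past_space" shows "(\<lambda>z. f z i) \<in> measurable L (count_space UNIV)"
  using assms unfolding past_space_def by measurable

lemma measurable_past_case_nat [measurable (raw)]:
  assumes [measurable]: "f \<in> measurable L past_space" "g \<in> measurable L (count_space UNIV)"
  shows "(\<lambda>z. case_nat (g z) (f z)) \<in> measurable L past_space"
proof -
  have [measurable]: "f \<in> measurable L (PiM UNIV (\<lambda>_. count_space UNIV))"
    using assms(1) by (simp add: past_space_def)
  show ?thesis unfolding past_space_def by measurable
qed

context sampler
begin

sublocale seq: sequence_space \<mu> ..

lemma space_law [simp]: "space \<mu> = UNIV"
  using sets_eq_imp_space_eq[OF sets_law] by simp

lemma space_seq [simp]: "space seq.S = UNIV"
  by (simp add: space_PiM)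

lemma sets_seq [measurable_cong]: "sets seq.S = sets (PiM UNIV (\<lambda>_::nat. borel))"
  by (intro sets_PiM_cong) (auto simp: sets_law)

lemma measurable_sample_comp [measurable (raw)]:
  assumes [measurable]: "f \<in> measurable L past_space" "g \<in> borel_measurable L"
  shows "(\<lambda>z. F (f z) (g z)) \<in> measurable L (count_space UNIV)"
  using measurable_compose[OF _ measurable_sample, of "\<lambda>z. (f z, g z)" L] by simp

lemma measurable_run [measurable (raw)]:
  assumes "f \<in> measurable L past_space" "g \<in> measurable L (PiM UNIV (\<lambda>_::nat. borel))"
  shows "(\<lambda>z. run F m (f z) (g z)) \<in> measurable L past_space"
  using assms
proof (induction m arbitrary: f g)
  case (Suc m)
  note [measurable] = Suc.prems
  have [measurable]: "(\<lambda>z. g z i) \<in> borel_measurable L" for i by measurable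
  have "(\<lambda>z i. g z (Suc i)) \<in> measurable L (PiM UNIV (\<lambda>_::nat. borel))"
    by (rule measurable_PiM_single') auto
  thus ?case unfolding run.simps by (intro Suc.IH) measurable
qed simp

text \<open>Induction on the first step with a shared input. Pasts agreeing on \<open>l\<close>
  letters produce the same letter, and then agree on \<open>Suc l\<close>, except with probability
  at most \<open>c * delta p l\<close>; after a disagreement nothing is assumed, which is level 0 of
  the chain.\<close>

lemma run_gap:
  assumes "cond_law p" and c: "0 \<le> c" "c * delta p 0 \<le> 1" and agree: "\<And>i. i < l \<Longrightarrow> x i = y i"
  shows "measure seq.S {u. run F m x u 0 \<noteq> run F m y u 0} \<le> hit (\<lambda>l. 1 - c * delta p l) m l"
  using agree
proof (induction m arbitrary: x y l)
  case 0
  show ?case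
  proof (cases "l = 0")
    case False
    hence "{u. run F 0 x u 0 \<noteq> run F 0 y u 0} = {}" using 0 by auto
    thus ?thesis by (simp del: run.simps)
  qed simp
next
  case (Suc m)
  interpret cond_law p by fact
  let ?r = "\<lambda>l. 1 - c * delta p l"
  have r: "0 \<le> ?r l" "?r l \<le> 1" for l
  proof -
    have "c * delta p l \<le> c * delta p 0"
      using c decseqD[OF decseq_delta, of 0 l] by (intro mult_left_mono) auto
    thus "0 \<le> ?r l" using c by simp
    show "?r l \<le> 1" using c delta_nonneg by simp
  qed
  have r_mono: "incseq ?r"
    using c decseqD[OF decseq_delta] by (auto simp: incseq_def intro!: mult_left_mono)
  let ?h = "hit ?r m"
  have h0: "0 \<le> ?h k" "?h k \<le> ?h 0" for k
    using hit_nonneg[OF r r_mono] hit_antimono[OF r r_mono] by auto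
  define D where "D = {s. F x s \<noteq> F y s}"
  have D [measurable]: "D \<in> sets \<mu>"
    unfolding D_def using measurable_sample_comp[of "\<lambda>_. x" \<mu> "\<lambda>s. s"] measurable_sample_comp[of "\<lambda>_. y" \<mu> "\<lambda>s. s"]
    by measurable
  define E where "E k x y = {u. run F k x u 0 \<noteq> run F k y u 0}" for k x y
  have E [measurable]: "E k x y \<in> sets seq.S" for k x y
  proof -
    have "Measurable.pred seq.S (\<lambda>u. run F k x u 0 \<noteq> run F k y u 0)" by measurable
    thus ?thesis by (simp add: pred_def E_def)
  qed
  have step: "emeasure seq.S {\<omega>. case_nat s \<omega> \<in> E (Suc m) x y} \<le>
      ennreal (?h (Suc l) + (?h 0 - ?h (Suc l)) * indicator D s)" for s
  proof -
    have "{\<omega>. case_nat s \<omega> \<in> E (Suc m) x y} = E m (case_nat (F x s) x) (case_nat (F y s) y)"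
      by (auto simp: E_def)
    moreover have "measure seq.S (E m (case_nat (F x s) x) (case_nat (F y s) y)) \<le> ?h (if s \<in> D then 0 else Suc l)"
      unfolding E_def by (rule Suc.IH) (use Suc.prems in \<open>auto simp: D_def split: nat.split if_splits\<close>)
    ultimately show ?thesis
      by (auto simp: seq.emeasure_eq_measure intro!: ennreal_leI split: if_splits)
  qed
  \<comment> \<open>The first input is peeled off: the law of the i.i.d. sequence is the image under
    \<open>case_nat\<close> of one input and an independent copy of the sequence.\<close>
  have "emeasure seq.S (E (Suc m) x y) =
      emeasure (distr (\<mu> \<Otimes>\<^sub>M seq.S) seq.S (\<lambda>(s, \<omega>). case_nat s \<omega>)) (E (Suc m) x y)"
    by (simp only: seq.PiM_iter)
  also have "\<dots> = emeasure (\<mu> \<Otimes>\<^sub>M seq.S) ((\<lambda>(s, \<omega>). case_nat s \<omega>) -` E (Suc m) x y)"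
    by (subst emeasure_distr) (auto simp: space_pair_measure)
  also have "\<dots> = (\<integral>\<^sup>+s. emeasure seq.S {\<omega>. case_nat s \<omega> \<in> E (Suc m) x y} \<partial>\<mu>)"
  proof (subst seq.emeasure_pair_measure_alt)
    have "(\<lambda>(s, \<omega>). case_nat s \<omega>) -` E (Suc m) x y \<inter> space (\<mu> \<Otimes>\<^sub>M seq.S) \<in> sets (\<mu> \<Otimes>\<^sub>M seq.S)"
      by measurable
    thus "(\<lambda>(s, \<omega>). case_nat s \<omega>) -` E (Suc m) x y \<in> sets (\<mu> \<Otimes>\<^sub>M seq.S)"
      by (simp add: space_pair_measure)
  qed (auto intro!: nn_integral_cong arg_cong[where f = "emeasure seq.S"])
  also have "\<dots> \<le> (\<integral>\<^sup>+s. ennreal (?h (Suc l) + (?h 0 - ?h (Suc l)) * indicator D s) \<partial>\<mu>)"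
    by (intro nn_integral_mono step)
  also have "\<dots> = ennreal (?h (Suc l) + (?h 0 - ?h (Suc l)) * prob D)"
  proof -
    have int: "integrable \<mu> (\<lambda>s. indicator D s :: real)"
      by (rule integrable_real_indicator) (auto simp: emeasure_eq_measure)
    have [simp]: "prob UNIV = 1" using prob_space by simp
    have "(\<integral>s. ?h (Suc l) + (?h 0 - ?h (Suc l)) * indicator D s \<partial>\<mu>) =
        ?h (Suc l) + (?h 0 - ?h (Suc l)) * prob D"
      using int by (subst Bochner_Integration.integral_add) auto
    thus ?thesis
      using int h0 by (subst nn_integral_eq_integral) auto
  qed
  finally have "measure seq.S (E (Suc m) x y) \<le> ?h (Suc l) + (?h 0 - ?h (Suc l)) * prob D"
    unfolding seq.emeasure_eq_measure by (subst (asm) ennreal_le_iff) (use h0 in auto)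
  \<comment> \<open>Level 0 is the worst start, so the coefficient of \<open>prob D\<close> is
    nonnegative and an upper bound on \<open>prob D\<close> suffices.\<close>
  also have "\<dots> \<le> ?h (Suc l) + (?h 0 - ?h (Suc l)) * (c * delta p l)"
  proof (intro add_left_mono mult_left_mono)
    have "prob D \<le> c * tv_dist (p x) (p y)" unfolding D_def by (rule sample_gap)
    also have "\<dots> \<le> c * delta p l" using tv_dist_le_delta[of l x y] Suc.prems c by (intro mult_left_mono) auto
    finally show "prob D \<le> c * delta p l" .
  qed (use h0 in auto)
  also have "\<dots> = hit ?r (Suc m) l" by (simp add: algebra_simps)
  finally show ?case by (simp add: E_def)
qed

end

section \<open>Extending the probability space\<close>

text \<open>Time \<open>n\<close> itself is excluded, so that \<open>p (past X n w)\<close> is the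
  conditional law of \<open>X n\<close>; at time 0 this is \<open>past_of X\<close>.\<close>

definition past :: "(int \<Rightarrow> 'w \<Rightarrow> 'a) \<Rightarrow> int \<Rightarrow> 'w \<Rightarrow> nat \<Rightarrow> 'a" where
  "past X n \<omega> m = X (n - 1 - int m) \<omega>"

lemma past_eq_shift: "k \<le> n \<Longrightarrow> past X k \<omega> m = past X n \<omega> (m + nat (n - k))"
  by (simp add: past_def algebra_simps)

lemma past_Suc: "past X (n + 1) \<omega> = case_nat (X n \<omega>) (past X n \<omega>)"
  by (auto simp: past_def fun_eq_iff algebra_simps split: nat.split)

lemma measurable_past_spaceI:
  assumes "\<And>m. (\<lambda>z. f z m) \<in> measurable L (count_space UNIV)"
  shows "f \<in> measurable L past_space"
  unfolding past_space_def by (rule measurable_PiM_single') (use assms in auto)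

locale sampled_process = sampler \<mu> p c F + cond_law p + X: prob_space M
  for \<mu> :: "real measure" and p :: "(nat \<Rightarrow> 'a::finite) \<Rightarrow> 'a \<Rightarrow> real" and c F
    and M :: "'w measure" +
  fixes X :: "int \<Rightarrow> 'w \<Rightarrow> 'a"
  assumes measurable_X [measurable]: "X n \<in> measurable M (count_space UNIV)"
    and stat: "stationary M X" and law: "regular_cond_law M X p"
begin

lemma measurable_past [measurable]: "past X n \<in> measurable M past_space"
  by (rule measurable_past_spaceI) (simp add: past_def)

text \<open>At time 0 the defining property of \<open>p\<close> says that two densities have the
  same image under the past, which extends it from events to all nonnegative \<open>h\<close>. Both
  sides are functionals of the trajectory, so stationarity carries the identity to time
  \<open>n\<close>.\<close>

lemma nn_integral_cond_law:
  assumes [measurable]: "h \<in> borel_measurable past_space"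
  shows "(\<integral>\<^sup>+\<omega>. indicator {a} (X n \<omega>) * h (past X n \<omega>) \<partial>M) =
    (\<integral>\<^sup>+\<omega>. ennreal (p (past X n \<omega>) a) * h (past X n \<omega>) \<partial>M)"
proof -
  let ?Q = "PiM UNIV (\<lambda>_::int. count_space (UNIV :: 'a set))"
  have shift: "(\<integral>\<^sup>+\<omega>. G (\<lambda>k. X (k + n) \<omega>) \<partial>M) = (\<integral>\<^sup>+\<omega>. G (\<lambda>k. X k \<omega>) \<partial>M)"
    if [measurable]: "G \<in> borel_measurable ?Q" for G :: "(int \<Rightarrow> 'a) \<Rightarrow> ennreal"
  proof -
    have [measurable]: "(\<lambda>\<omega> k. X (k + n) \<omega>) \<in> measurable M ?Q" for n
      by (rule measurable_PiM_single') auto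
    have [measurable]: "(\<lambda>\<omega> k. X k \<omega>) \<in> measurable M ?Q"
      by (rule measurable_PiM_single') auto
    have "(\<integral>\<^sup>+z. G z \<partial>distr M ?Q (\<lambda>\<omega> k. X (k + n) \<omega>)) = (\<integral>\<^sup>+z. G z \<partial>distr M ?Q (\<lambda>\<omega> k. X k \<omega>))"
      using stat unfolding stationary_def by simp
    thus ?thesis by (simp add: nn_integral_distr)
  qed
  have zero: "(\<integral>\<^sup>+\<omega>. indicator {a} (X 0 \<omega>) * h (past X 0 \<omega>) \<partial>M) =
    (\<integral>\<^sup>+\<omega>. ennreal (p (past X 0 \<omega>) a) * h (past X 0 \<omega>) \<partial>M)"
  proof -
    have past0: "past_of X = past X 0"
      unfolding fun_eq_iff past_of_def past_def by (intro allI arg_cong[where f = "\<lambda>k. X k _"]) simp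
    have "distr (density M (\<lambda>\<omega>. indicator {a} (X 0 \<omega>))) past_space (past X 0) =
        distr (density M (\<lambda>\<omega>. ennreal (p (past X 0 \<omega>) a))) past_space (past X 0)"
    proof (rule measure_eqI)
      fix B assume "B \<in> sets (distr (density M (\<lambda>\<omega>. indicator {a} (X 0 \<omega>))) past_space (past X 0))"
      hence B [measurable]: "B \<in> sets past_space" by simp
      have le: "p x a \<le> 1" for x
        using member_le_sum[of a UNIV "p x"] nonneg sum1[of x] by auto
      have "(\<integral>\<^sup>+\<omega>. ennreal (p (past X 0 \<omega>) a) * indicator (past X 0 -` B \<inter> space M) \<omega> \<partial>M) =
          (\<integral>\<^sup>+\<omega>. ennreal (indicator B (past_of X \<omega>) * p (past_of X \<omega>) a) \<partial>M)"
        by (intro nn_integral_cong) (auto simp: past0 split: split_indicator)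
      also have "\<dots> = ennreal (\<integral>\<omega>. indicator B (past_of X \<omega>) * p (past_of X \<omega>) a \<partial>M)"
      proof (rule nn_integral_eq_integral)
        show "integrable M (\<lambda>\<omega>. indicator B (past_of X \<omega>) * p (past_of X \<omega>) a)"
          unfolding past0
          by (rule X.integrable_const_bound[where B = 1])
            (use nonneg le in \<open>auto split: split_indicator\<close>)
      qed (use nonneg in auto)
      also have "\<dots> = emeasure M {\<omega> \<in> space M. X 0 \<omega> = a \<and> past_of X \<omega> \<in> B}"
        using law B unfolding regular_cond_law_def by (simp add: X.emeasure_eq_measure)
      also have "\<dots> = (\<integral>\<^sup>+\<omega>. indicator {\<omega> \<in> space M. X 0 \<omega> = a \<and> past X 0 \<omega> \<in> B} \<omega> \<partial>M)"
        by (simp add: past0)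
      also have "\<dots> = (\<integral>\<^sup>+\<omega>. indicator {a} (X 0 \<omega>) * indicator (past X 0 -` B \<inter> space M) \<omega> \<partial>M)"
        by (intro nn_integral_cong) (auto split: split_indicator)
      finally show "emeasure (distr (density M (\<lambda>\<omega>. indicator {a} (X 0 \<omega>))) past_space (past X 0)) B =
          emeasure (distr (density M (\<lambda>\<omega>. ennreal (p (past X 0 \<omega>) a))) past_space (past X 0)) B"
        by (simp add: emeasure_distr emeasure_density)
    qed simp
    from arg_cong[where f = "\<lambda>N. nn_integral N h", OF this] show ?thesis
      by (simp add: nn_integral_distr nn_integral_density)
  qed
  define G1 G2 where "G1 z = indicator {a} (z 0) * h (\<lambda>m. z (- 1 - int m))"
    and "G2 z = ennreal (p (\<lambda>m. z (- 1 - int m)) a) * h (\<lambda>m. z (- 1 - int m))" for z :: "int \<Rightarrow> 'a"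
  have [measurable]: "(\<lambda>z m. z (- 1 - int m)) \<in> measurable ?Q past_space"
    by (rule measurable_past_spaceI) measurable
  have G [measurable]: "G1 \<in> borel_measurable ?Q" "G2 \<in> borel_measurable ?Q"
    unfolding G1_def G2_def by measurable
  have "past X n \<omega> = (\<lambda>m. X (- 1 - int m + n) \<omega>)" "past X 0 \<omega> = (\<lambda>m. X (- 1 - int m) \<omega>)" for \<omega>
    by (auto simp: past_def fun_eq_iff algebra_simps)
  thus ?thesis using shift[OF G(1)] shift[OF G(2)] zero by (simp add: G1_def G2_def)
qed

lemma nn_integral_split:
  assumes [measurable]: "\<And>a. h a \<in> borel_measurable past_space"
  shows "(\<integral>\<^sup>+\<omega>. h (X n \<omega>) (past X n \<omega>) \<partial>M) =
    (\<integral>\<^sup>+\<omega>. (\<Sum>a\<in>UNIV. ennreal (p (past X n \<omega>) a) * h a (past X n \<omega>)) \<partial>M)"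
proof -
  have "(\<integral>\<^sup>+\<omega>. h (X n \<omega>) (past X n \<omega>) \<partial>M) =
      (\<integral>\<^sup>+\<omega>. (\<Sum>a\<in>UNIV. indicator {a} (X n \<omega>) * h a (past X n \<omega>)) \<partial>M)"
  proof (intro nn_integral_cong)
    fix \<omega>
    have "(\<Sum>a\<in>UNIV. indicator {a} (X n \<omega>) * h a (past X n \<omega>)) =
        (\<Sum>a\<in>UNIV. if a = X n \<omega> then h a (past X n \<omega>) else 0)"
      by (intro sum.cong) (auto split: split_indicator)
    thus "h (X n \<omega>) (past X n \<omega>) = (\<Sum>a\<in>UNIV. indicator {a} (X n \<omega>) * h a (past X n \<omega>))"
      by simp
  qed
  also have "\<dots> = (\<Sum>a\<in>UNIV. \<integral>\<^sup>+\<omega>. indicator {a} (X n \<omega>) * h a (past X n \<omega>) \<partial>M)"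
    by (rule nn_integral_sum) measurable
  also have "\<dots> = (\<Sum>a\<in>UNIV. \<integral>\<^sup>+\<omega>. ennreal (p (past X n \<omega>) a) * h a (past X n \<omega>) \<partial>M)"
    by (intro sum.cong refl nn_integral_cond_law) measurable
  also have "\<dots> = (\<integral>\<^sup>+\<omega>. (\<Sum>a\<in>UNIV. ennreal (p (past X n \<omega>) a) * h a (past X n \<omega>)) \<partial>M)"
    by (rule nn_integral_sum[symmetric]) measurable
  finally show ?thesis .
qed

text \<open>Conditioning the source on the letter \<open>X n\<close> requires that this letter have
  positive probability given the past; otherwise rejection might never stop.\<close>

lemma AE_law_pos: "AE \<omega> in M. p (past X n \<omega>) (X n \<omega>) > 0"
proof -
  have "(\<integral>\<^sup>+\<omega>. indicator {x. p x (X n \<omega>) = 0} (past X n \<omega>) \<partial>M) =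
     (\<integral>\<^sup>+\<omega>. (\<Sum>a\<in>UNIV. ennreal (p (past X n \<omega>) a) * indicator {x. p x a = 0} (past X n \<omega>)) \<partial>M)"
  proof (rule nn_integral_split)
    fix a
    have "{x \<in> space past_space. p x a = 0} \<in> sets past_space" by measurable
    thus "indicator {x. p x a = 0} \<in> borel_measurable past_space" by simp
  qed
  also have "\<dots> = (\<integral>\<^sup>+\<omega>. 0 \<partial>M)"
    by (intro nn_integral_cong sum.neutral) (auto split: split_indicator)
  also have "\<dots> = 0" by simp
  finally have "(\<integral>\<^sup>+\<omega>. indicator {x. p x (X n \<omega>) = 0} (past X n \<omega>) \<partial>M) = 0" .
  moreover have "(\<lambda>\<omega>. indicator {x. p x (X n \<omega>) = 0} (past X n \<omega>) :: ennreal) \<in> borel_measurable M"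
  proof -
    have [measurable]: "(\<lambda>\<omega>. p (past X n \<omega>) (X n \<omega>)) \<in> borel_measurable M"
      by (rule measurable_compose_countable[where f = "\<lambda>a \<omega>. p (past X n \<omega>) a"]) measurable
    have "(\<lambda>\<omega>. indicator {0} (p (past X n \<omega>) (X n \<omega>)) :: ennreal) \<in> borel_measurable M" by measurable
    thus ?thesis by (simp add: indicator_def)
  qed
  ultimately have "AE \<omega> in M. indicator {x. p x (X n \<omega>) = 0} (past X n \<omega>) = (0 :: ennreal)"
    by (subst (asm) nn_integral_0_iff_AE)
  thus ?thesis
    by eventually_elim (use nonneg in \<open>auto simp: indicator_def less_le split: if_splits\<close>)
qed

section \<open>The extension and the source rebuilt from \<open>X\<close>\<close>

definition coord_law :: "real measure" where
  "coord_law = distr seq.S borel seq_encode"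

definition ext :: "('w \<times> (int \<Rightarrow> real)) measure" where
  "ext = M \<Otimes>\<^sub>M PiM UNIV (\<lambda>_::int. coord_law)"

definition resample :: "(nat \<Rightarrow> 'a) \<Rightarrow> 'a \<Rightarrow> real \<Rightarrow> real" where
  "resample x a v = first_in (\<lambda>r. F x r = a) (seq_decode v)"

text \<open>Rejection on an auxiliary i.i.d. sequence (one encoded real per time) realizes the law of the
  source conditioned on producing the letter \<open>X n\<close>.\<close>

definition U :: "int \<Rightarrow> 'w \<times> (int \<Rightarrow> real) \<Rightarrow> real" where
  "U n z = resample (past X n (fst z)) (X n (fst z)) (snd z n)"

text \<open>The conditional law of the source given past \<open>x\<close> and letter
  \<open>a\<close>: where \<open>p x a\<close> is positive it is the source law conditioned on
  \<open>F x = a\<close>.\<close>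

definition kern :: "real set \<Rightarrow> (nat \<Rightarrow> 'a) \<Rightarrow> 'a \<Rightarrow> ennreal" where
  "kern B x a = (\<integral>\<^sup>+v. indicator B (resample x a v) \<partial>coord_law)"

lemma measurable_seq_encode_S [measurable]: "seq_encode \<in> measurable seq.S borel"
  using measurable_seq_encode by (simp cong: measurable_cong_sets add: sets_seq)

sublocale coord: prob_space coord_law
  unfolding coord_law_def by (rule seq.prob_space_distr) measurable

lemma sets_coord_law [measurable_cong, simp]: "sets coord_law = sets borel"
  by (simp add: coord_law_def)

lemma space_coord_law [simp]: "space coord_law = UNIV"
  by (simp add: coord_law_def)

sublocale coords: product_prob_space "\<lambda>_::int. coord_law" UNIV ..

sublocale ext_pair: pair_prob_space M "PiM UNIV (\<lambda>_::int. coord_law)" ..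

lemma prob_space_ext: "prob_space ext"
  unfolding ext_def by unfold_locales

lemma measurable_resample [measurable (raw)]:
  assumes [measurable]: "f \<in> measurable L past_space" "g \<in> measurable L (count_space UNIV)" "h \<in> borel_measurable L"
  shows "(\<lambda>z. resample (f z) (g z) (h z)) \<in> borel_measurable L"
  unfolding resample_def
proof (rule measurable_first_in)
  have "Measurable.pred (L \<Otimes>\<^sub>M borel) (\<lambda>z. \<exists>b. F (f (fst z)) (snd z) = b \<and> g (fst z) = b)"
    by measurable
  thus "Measurable.pred (L \<Otimes>\<^sub>M borel) (\<lambda>(z, r). F (f z) r = g z)"
    by (simp add: case_prod_beta eq_commute)
qed measurable

lemma measurable_fst_ext [measurable]: "fst \<in> measurable ext M"
  by (simp add: ext_def)

lemma measurable_U [measurable]: "U n \<in> borel_measurable ext"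
  unfolding U_def ext_def by measurable

lemma measurable_kern [measurable (raw)]:
  assumes [measurable]: "f \<in> measurable L past_space" "g \<in> measurable L (count_space UNIV)" "B \<in> sets borel"
  shows "(\<lambda>z. kern B (f z) (g z)) \<in> borel_measurable L"
  unfolding kern_def by measurable

lemma kern_eq:
  assumes B [measurable]: "B \<in> sets borel"
  shows "{v. resample x a v \<in> B} \<in> sets coord_law"
    and "kern B x a = emeasure coord_law {v. resample x a v \<in> B}"
proof -
  have [measurable]: "resample x a \<in> borel_measurable borel"
    by (rule measurable_resample) auto
  show *: "{v. resample x a v \<in> B} \<in> sets coord_law"
    using measurable_sets[of "resample x a" borel borel B] by (auto simp: vimage_def)
  have "kern B x a = (\<integral>\<^sup>+v. indicator {v. resample x a v \<in> B} v \<partial>coord_law)"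
    unfolding kern_def by (intro nn_integral_cong) (auto split: split_indicator)
  thus "kern B x a = emeasure coord_law {v. resample x a v \<in> B}"
    using * by simp
qed

text \<open>Total probability: averaging the conditioned source laws over the letter, with weights
  \<open>p x a\<close>, restores the unconditioned one. The result is independent of
  \<open>x\<close>, hence each new \<open>U n\<close> has law \<open>\<mu>\<close> whatever the
  past.\<close>

lemma kern_mixture:
  assumes B [measurable]: "B \<in> sets borel"
  shows "(\<Sum>a\<in>UNIV. ennreal (p x a) * kern B x a) = emeasure \<mu> B"
proof -
  have mF [measurable]: "Measurable.pred \<mu> (\<lambda>r. F x r = a)" for a
    using measurable_sample_comp[of "\<lambda>_. x" \<mu> "\<lambda>s. s"] by measurable
  have "ennreal (p x a) * kern B x a = emeasure \<mu> {r. F x r = a \<and> r \<in> B}" for a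
  proof (cases "p x a = 0")
    \<comment> \<open>Here \<open>kern\<close> is uncontrolled, but its weight is 0 and so is the
      probability of producing \<open>a\<close>.\<close>
    case True
    have "prob {r. F x r = a \<and> r \<in> B} \<le> prob {r. F x r = a}"
      by (rule finite_measure_mono) (use mF[of a] in \<open>auto simp: pred_def\<close>)
    thus ?thesis using True sample_law[of x a] by (simp add: emeasure_eq_measure measure_le_0_iff)
  next
    case False
    hence pos: "p x a > 0" using nonneg[of x a] by simp
    have ms: "{t. first_in (\<lambda>r. F x r = a) t \<in> B} \<in> sets seq.S"
    proof -
      have "Measurable.pred seq.S (\<lambda>t. first_in (\<lambda>r. F x r = a) t \<in> B)" by measurable
      thus ?thesis by (simp add: pred_def)
    qed
    have [measurable]: "resample x a \<in> borel_measurable borel" by (rule measurable_resample) auto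
    have "kern B x a = emeasure coord_law {v. resample x a v \<in> B}"
      by (rule kern_eq(2)[OF B])
    also have "\<dots> = emeasure seq.S {t. first_in (\<lambda>r. F x r = a) t \<in> B}"
      unfolding coord_law_def by (subst emeasure_distr) (auto simp: resample_def seq_decode_encode vimage_def)
    also have "\<dots> = ennreal (prob {r. F x r = a \<and> r \<in> B} / p x a)"
      using first_in_law(2)[of "\<lambda>r. F x r = a" "\<lambda>r. r \<in> B"] sample_law[of x a] pos
      by (simp add: seq.emeasure_eq_measure)
    finally show ?thesis using pos
      by (simp add: ennreal_mult[symmetric] emeasure_eq_measure)
  qed
  hence "(\<Sum>a\<in>UNIV. ennreal (p x a) * kern B x a) = (\<Sum>a\<in>UNIV. emeasure \<mu> {r. F x r = a \<and> r \<in> B})"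
    by simp
  also have "\<dots> = emeasure \<mu> (\<Union>a. {r. F x r = a \<and> r \<in> B})"
    by (rule sum_emeasure) (use mF in \<open>auto simp: pred_def disjoint_family_on_def\<close>)
  also have "(\<Union>a. {r. F x r = a \<and> r \<in> B}) = B" by auto
  finally show ?thesis .
qed

text \<open>Given the trajectory of \<open>X\<close>, distinct \<open>U k\<close> use distinct
  independent coordinates, so they are conditionally independent with laws \<open>kern\<close>.
  Integrating these coordinates out leaves an integral over \<open>M\<close>.\<close>

lemma nn_integral_ext:
  assumes J: "finite J" and [measurable]: "h \<in> borel_measurable M" and B [measurable]: "\<And>k. B k \<in> sets borel"
  shows "(\<integral>\<^sup>+z. h (fst z) * (\<Prod>k\<in>J. indicator (B k) (U k z)) \<partial>ext) =
    (\<integral>\<^sup>+\<omega>. h \<omega> * (\<Prod>k\<in>J. kern (B k) (past X k \<omega>) (X k \<omega>)) \<partial>M)"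
proof -
  have "(\<lambda>z. h (fst z) * (\<Prod>k\<in>J. indicator (B k) (U k z)) :: ennreal) \<in> borel_measurable ext"
    by measurable
  hence "(\<integral>\<^sup>+z. h (fst z) * (\<Prod>k\<in>J. indicator (B k) (U k z)) \<partial>ext) =
    (\<integral>\<^sup>+\<omega>. \<integral>\<^sup>+v. h \<omega> * (\<Prod>k\<in>J. indicator (B k) (U k (\<omega>, v))) \<partial>PiM UNIV (\<lambda>_. coord_law) \<partial>M)"
    unfolding ext_def by (subst coords.P.nn_integral_fst[symmetric]) auto
  also have "\<dots> = (\<integral>\<^sup>+\<omega>. h \<omega> * (\<Prod>k\<in>J. kern (B k) (past X k \<omega>) (X k \<omega>)) \<partial>M)"
  proof (intro nn_integral_cong)
    fix \<omega> assume "\<omega> \<in> space M"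
    let ?A = "\<lambda>k. {v. resample (past X k \<omega>) (X k \<omega>) v \<in> B k}"
    have A: "?A k \<in> sets coord_law" for k
      by (rule kern_eq(1)[OF B])
    have kern: "kern (B k) (past X k \<omega>) (X k \<omega>) = emeasure coord_law (?A k)" for k
      by (rule kern_eq(2)[OF B])
    have ind: "(\<Prod>k\<in>J. indicator (B k) (U k (\<omega>, v)) :: ennreal) =
        indicator {v \<in> space (PiM UNIV (\<lambda>_. coord_law)). \<forall>k\<in>J. v k \<in> ?A k} v" for v
      using J by (induction J) (auto simp: U_def space_PiM split: split_indicator)
    have C: "{v \<in> space (PiM UNIV (\<lambda>_. coord_law)). \<forall>k\<in>J. v k \<in> ?A k} \<in> sets (PiM UNIV (\<lambda>_. coord_law))"
      using J A by (intro sets.sets_Collect_finite_All) (auto intro!: sets_Collect_single')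
    have P: "emeasure (PiM UNIV (\<lambda>_. coord_law)) {v \<in> space (PiM UNIV (\<lambda>_. coord_law)). \<forall>k\<in>J. v k \<in> ?A k} =
        (\<Prod>k\<in>J. emeasure coord_law (?A k))"
      by (rule coords.emeasure_PiM_Collect) (use J A in auto)
    show "(\<integral>\<^sup>+v. h \<omega> * (\<Prod>k\<in>J. indicator (B k) (U k (\<omega>, v))) \<partial>PiM UNIV (\<lambda>_. coord_law)) =
        h \<omega> * (\<Prod>k\<in>J. kern (B k) (past X k \<omega>) (X k \<omega>))"
      unfolding ind kern P[symmetric] by (rule nn_integral_cmult_indicator[OF C])
  qed
  finally show ?thesis .
qed

text \<open>The factor of index \<open>k\<close> involves letters up to time \<open>k\<close> only,
  and \<open>X k\<close> sits at position \<open>n - 1 - k\<close> of \<open>past X n\<close>. This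
  allows conditioning at time \<open>n\<close> with the whole product frozen.\<close>

lemma kern_prod_past:
  assumes J: "finite J" "\<And>k. k \<in> J \<Longrightarrow> k < n" and B [measurable]: "\<And>k. B k \<in> sets borel"
  obtains g where "g \<in> borel_measurable past_space"
    "\<And>\<omega>. (\<Prod>k\<in>J. kern (B k) (past X k \<omega>) (X k \<omega>)) = g (past X n \<omega>)"
proof
  define sh :: "int \<Rightarrow> (nat \<Rightarrow> 'a) \<Rightarrow> nat \<Rightarrow> 'a" where "sh k x = (\<lambda>m. x (m + nat (n - k)))" for k x
  have [measurable]: "sh k \<in> measurable past_space past_space" for k
    unfolding sh_def by (rule measurable_past_spaceI) measurable
  let ?g = "\<lambda>x. \<Prod>k\<in>J. kern (B k) (sh k x) (x (nat (n - 1 - k)))"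
  show "?g \<in> borel_measurable past_space" by measurable
  fix \<omega>
  have "past X k \<omega> = sh k (past X n \<omega>)" "X k \<omega> = past X n \<omega> (nat (n - 1 - k))" if "k \<in> J" for k
    using J(2)[OF that] by (auto simp: sh_def past_def algebra_simps)
  thus "(\<Prod>k\<in>J. kern (B k) (past X k \<omega>) (X k \<omega>)) = ?g (past X n \<omega>)"
    by (intro prod.cong) auto
qed

text \<open>The latest time is removed first: all other factors are functions of the past before it,
  and averaging over its letter turns its factor into a constant by
  \<open>kern_mixture\<close>.\<close>

lemma nn_integral_kern_prod:
  assumes J: "finite J" "\<And>k. k \<in> J \<Longrightarrow> s \<le> k"
    and h: "h \<in> borel_measurable past_space" and B: "\<And>k. B k \<in> sets borel"
  shows "(\<integral>\<^sup>+\<omega>. h (past X s \<omega>) * (\<Prod>k\<in>J. kern (B k) (past X k \<omega>) (X k \<omega>)) \<partial>M) =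
    (\<integral>\<^sup>+\<omega>. h (past X s \<omega>) \<partial>M) * (\<Prod>k\<in>J. emeasure \<mu> (B k))"
  using J
proof (induction J rule: finite_linorder_max_induct)
  case (insert n J)
  note [measurable] = h B
  obtain g' where g' [measurable]: "g' \<in> borel_measurable past_space"
    and g'_eq: "\<And>\<omega>. (\<Prod>k\<in>J. kern (B k) (past X k \<omega>) (X k \<omega>)) = g' (past X n \<omega>)"
    using kern_prod_past[of J n B] insert.hyps B by auto
  define g where "g x = h (\<lambda>m. x (m + nat (n - s))) * g' x" for x
  have [measurable]: "(\<lambda>x m. x (m + nat (n - s))) \<in> measurable past_space (past_space :: (nat \<Rightarrow> 'a) measure)"
    by (rule measurable_past_spaceI) measurable
  have g [measurable]: "g \<in> borel_measurable past_space"
    unfolding g_def by measurable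
  have "past X s \<omega> = (\<lambda>m. past X n \<omega> (m + nat (n - s)))" for \<omega>
    using insert.prems past_eq_shift[of s n X \<omega>] by auto
  hence g_eq: "h (past X s \<omega>) * (\<Prod>k\<in>J. kern (B k) (past X k \<omega>) (X k \<omega>)) = g (past X n \<omega>)" for \<omega>
    by (simp add: g_def g'_eq)
  have "(\<integral>\<^sup>+\<omega>. h (past X s \<omega>) * (\<Prod>k\<in>insert n J. kern (B k) (past X k \<omega>) (X k \<omega>)) \<partial>M) =
      (\<integral>\<^sup>+\<omega>. g (past X n \<omega>) * kern (B n) (past X n \<omega>) (X n \<omega>) \<partial>M)"
    using insert by (intro nn_integral_cong) (auto simp: g_eq[symmetric] mult_ac)
  also have "\<dots> = (\<integral>\<^sup>+\<omega>. (\<Sum>a\<in>UNIV. ennreal (p (past X n \<omega>) a) * (g (past X n \<omega>) * kern (B n) (past X n \<omega>) a)) \<partial>M)"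
    by (rule nn_integral_split) measurable
  also have "\<dots> = (\<integral>\<^sup>+\<omega>. g (past X n \<omega>) * emeasure \<mu> (B n) \<partial>M)"
  proof (intro nn_integral_cong)
    fix \<omega>
    have "(\<Sum>a\<in>UNIV. ennreal (p (past X n \<omega>) a) * (g (past X n \<omega>) * kern (B n) (past X n \<omega>) a)) =
        g (past X n \<omega>) * (\<Sum>a\<in>UNIV. ennreal (p (past X n \<omega>) a) * kern (B n) (past X n \<omega>) a)"
      by (simp add: sum_distrib_left mult_ac)
    thus "(\<Sum>a\<in>UNIV. ennreal (p (past X n \<omega>) a) * (g (past X n \<omega>) * kern (B n) (past X n \<omega>) a)) =
        g (past X n \<omega>) * emeasure \<mu> (B n)"
      by (simp only: kern_mixture[OF B])
  qed
  also have "\<dots> = (\<integral>\<^sup>+\<omega>. g (past X n \<omega>) \<partial>M) * emeasure \<mu> (B n)"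
    by (rule nn_integral_multc) measurable
  also have "(\<integral>\<^sup>+\<omega>. g (past X n \<omega>) \<partial>M) = (\<integral>\<^sup>+\<omega>. h (past X s \<omega>) \<partial>M) * (\<Prod>k\<in>J. emeasure \<mu> (B k))"
    using insert by (simp add: g_eq[symmetric])
  finally show ?case using insert by (auto simp: mult_ac)
qed simp

text \<open>With \<open>C\<close> the whole space the product form says that the \<open>U k\<close>
  are i.i.d.; with general \<open>C\<close>, that inputs from time \<open>s\<close> on are
  independent of the letters before \<open>s\<close>.\<close>

lemma emeasure_past_U:
  assumes J: "finite J" "\<And>k. k \<in> J \<Longrightarrow> s \<le> k"
    and C [measurable]: "C \<in> sets past_space" and B [measurable]: "\<And>k. B k \<in> sets borel"
  shows "emeasure ext {z \<in> space ext. past X s (fst z) \<in> C \<and> (\<forall>k\<in>J. U k z \<in> B k)} =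
    emeasure M (past X s -` C \<inter> space M) * (\<Prod>k\<in>J. emeasure \<mu> (B k))"
proof -
  have "{z \<in> space ext. past X s (fst z) \<in> C \<and> (\<forall>k\<in>J. U k z \<in> B k)} \<in> sets ext"
    using J(1) by measurable
  hence "emeasure ext {z \<in> space ext. past X s (fst z) \<in> C \<and> (\<forall>k\<in>J. U k z \<in> B k)} =
     (\<integral>\<^sup>+z. indicator {z \<in> space ext. past X s (fst z) \<in> C \<and> (\<forall>k\<in>J. U k z \<in> B k)} z \<partial>ext)"
    by simp
  also have "\<dots> = (\<integral>\<^sup>+z. indicator C (past X s (fst z)) * (\<Prod>k\<in>J. indicator (B k) (U k z)) \<partial>ext)"
  proof (rule nn_integral_cong)
    fix z assume "z \<in> space ext"
    moreover have "(\<Prod>k\<in>J. indicator (B k) (U k z) :: ennreal) = indicator {z. \<forall>k\<in>J. U k z \<in> B k} z"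
      using J(1) by (induction J) (auto split: split_indicator)
    ultimately show "indicator {z \<in> space ext. past X s (fst z) \<in> C \<and> (\<forall>k\<in>J. U k z \<in> B k)} z =
        (indicator C (past X s (fst z)) * (\<Prod>k\<in>J. indicator (B k) (U k z)) :: ennreal)"
      by (auto split: split_indicator)
  qed
  also have "\<dots> = (\<integral>\<^sup>+\<omega>. indicator C (past X s \<omega>) * (\<Prod>k\<in>J. kern (B k) (past X k \<omega>) (X k \<omega>)) \<partial>M)"
    by (rule nn_integral_ext[OF J(1)]) (use B in measurable)
  also have "\<dots> = (\<integral>\<^sup>+\<omega>. indicator C (past X s \<omega>) \<partial>M) * (\<Prod>k\<in>J. emeasure \<mu> (B k))"
    by (rule nn_integral_kern_prod[OF J]) (use B in measurable)
  also have "(\<integral>\<^sup>+\<omega>. indicator C (past X s \<omega>) \<partial>M) = (\<integral>\<^sup>+\<omega>. indicator (past X s -` C \<inter> space M) \<omega> \<partial>M)"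
    by (rule nn_integral_cong) (auto split: split_indicator)
  finally show ?thesis by simp
qed

text \<open>The observed letter almost surely has positive probability, so rejection stops, and by
  its very criterion it stops at a point producing \<open>X n\<close>.\<close>

lemma AE_sample_U: "AE z in ext. F (past X n (fst z)) (U n z) = X n (fst z)"
  unfolding ext_def
proof (rule ext_pair.AE_pair_measure)
  have "Measurable.pred (M \<Otimes>\<^sub>M PiM UNIV (\<lambda>_::int. coord_law))
      (\<lambda>z. \<exists>b. F (past X n (fst z)) (U n z) = b \<and> X n (fst z) = b)"
    unfolding U_def by measurable
  hence "Measurable.pred (M \<Otimes>\<^sub>M PiM UNIV (\<lambda>_::int. coord_law)) (\<lambda>z. F (past X n (fst z)) (U n z) = X n (fst z))"
    by (simp add: eq_commute)
  thus "{z \<in> space (M \<Otimes>\<^sub>M PiM UNIV (\<lambda>_::int. coord_law)). F (past X n (fst z)) (U n z) = X n (fst z)}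
      \<in> sets (M \<Otimes>\<^sub>M PiM UNIV (\<lambda>_::int. coord_law))"
    by (simp add: pred_def)
  show "AE \<omega> in M. AE v in PiM UNIV (\<lambda>_::int. coord_law).
      F (past X n (fst (\<omega>, v))) (U n (\<omega>, v)) = X n (fst (\<omega>, v))"
    using AE_law_pos[of n]
  proof eventually_elim
    case (elim \<omega>)
    let ?P = "\<lambda>r. F (past X n \<omega>) r = X n \<omega>"
    have m: "Measurable.pred borel ?P"
      using measurable_sample_comp[of "\<lambda>_. past X n \<omega>" borel "\<lambda>s. s"] by measurable
    have "AE t in seq.S. \<exists>i. ?P (t i)"
      using first_in_law(1)[of ?P "\<lambda>_. True"] m elim sample_law by simp
    hence "AE t in seq.S. ?P (resample (past X n \<omega>) (X n \<omega>) (seq_encode t))"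
    proof eventually_elim
      case (elim t)
      thus ?case unfolding resample_def seq_decode_encode using first_in[of ?P t] by blast
    qed
    moreover have "Measurable.pred borel (\<lambda>v. ?P (resample (past X n \<omega>) (X n \<omega>) v))"
      by (rule measurable_compose[OF _ m]) (rule measurable_resample; simp)
    ultimately have "AE v in coord_law. ?P (resample (past X n \<omega>) (X n \<omega>) v)"
      unfolding coord_law_def by (subst AE_distr_iff) (auto simp: pred_def)
    hence "AE v in PiM UNIV (\<lambda>_::int. coord_law). ?P (resample (past X n \<omega>) (X n \<omega>) (v n))"
      by (rule coords.AE_component[rotated]) simp
    thus ?case by (simp add: U_def)
  qed
qed

end

section \<open>The driving sequence\<close>

text \<open>Unlike \<open>past\<close>, time \<open>n\<close> is included.\<close>

definition hist :: "(int \<Rightarrow> 'b \<Rightarrow> 'c) \<Rightarrow> int \<Rightarrow> 'b \<Rightarrow> nat \<Rightarrow> 'c" where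
  "hist Y n \<omega> j = Y (n - int j) \<omega>"

lemma space_gen_filt [simp]: "space (gen_filt N S Y n) = space N"
  unfolding gen_filt_def by (rule space_measure_of_conv)

lemma gen_filt_generators:
  "{Y k -` B \<inter> space N | k B. k \<le> n \<and> B \<in> sets S} \<union> null_sets (completion N) \<subseteq> Pow (space N)"
  using sets.sets_into_space[of _ "completion N"] by (auto simp: null_sets_def)

lemma sets_gen_filt: "sets (gen_filt N S Y n) = sigma_sets (space N)
    ({Y k -` B \<inter> space N | k B. k \<le> n \<and> B \<in> sets S} \<union> null_sets (completion N))"
  unfolding gen_filt_def by (rule sets_measure_of[OF gen_filt_generators])

lemma gen_filt_null: "A \<in> null_sets (completion N) \<Longrightarrow> A \<in> sets (gen_filt N S Y n)"
  unfolding sets_gen_filt by (rule sigma_sets.Basic) blast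

lemma gen_filt_mono: "m \<le> n \<Longrightarrow> sets (gen_filt N S Y m) \<subseteq> sets (gen_filt N S Y n)"
  unfolding sets_gen_filt by (rule sigma_sets_mono') force

lemma measurable_gen_filt:
  assumes "Y k \<in> measurable N S" "k \<le> n" shows "Y k \<in> measurable (gen_filt N S Y n) S"
proof (rule measurableI)
  show "Y k \<omega> \<in> space S" if "\<omega> \<in> space (gen_filt N S Y n)" for \<omega>
    using that measurable_space[OF assms(1)] by simp
  show "Y k -` B \<inter> space (gen_filt N S Y n) \<in> sets (gen_filt N S Y n)" if "B \<in> sets S" for B
    unfolding sets_gen_filt using that assms(2) by (auto intro!: sigma_sets.Basic)
qed

lemma subalgebra_gen_filt:
  assumes "\<And>k. Y k \<in> measurable N S" shows "subalgebra (completion N) (gen_filt N S Y n)"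
  unfolding subalgebra_def
proof
  have "Y k -` B \<inter> space N \<in> sets (completion N)" if "B \<in> sets S" for k B
    using measurable_sets[OF assms that] by (rule sets_completionI_sets)
  hence "{Y k -` B \<inter> space N | k B. k \<le> n \<and> B \<in> sets S} \<union> null_sets (completion N) \<subseteq> sets (completion N)"
    by auto
  thus "sets (gen_filt N S Y n) \<subseteq> sets (completion N)"
    unfolding sets_gen_filt by (rule sets.sigma_sets_subset[of _ "completion N", simplified])
qed simp

lemma gen_filt_AE_cong:
  assumes A: "A \<in> sets (gen_filt N S Y n)" and B: "B \<subseteq> space N" and AE: "AE \<omega> in N. \<omega> \<in> A \<longleftrightarrow> \<omega> \<in> B"
  shows "B \<in> sets (gen_filt N S Y n)"
proof -
  obtain Z where Z: "Z \<in> null_sets N" "{\<omega> \<in> space N. \<not> (\<omega> \<in> A \<longleftrightarrow> \<omega> \<in> B)} \<subseteq> Z"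
    using AE unfolding eventually_ae_filter by blast
  have "A \<subseteq> space N" using sets.sets_into_space[OF A] by simp
  hence "A - B \<subseteq> Z" "B - A \<subseteq> Z" using Z B by auto
  hence "A - B \<in> sets (gen_filt N S Y n)" "B - A \<in> sets (gen_filt N S Y n)"
    using Z(1) by (metis gen_filt_null null_sets_completion_iff2)+
  hence "(A - (A - B)) \<union> (B - A) \<in> sets (gen_filt N S Y n)" using A by blast
  moreover have "(A - (A - B)) \<union> (B - A) = B" by blast
  ultimately show ?thesis by simp
qed

lemma measurable_hist:
  assumes "\<And>k. k \<le> n \<Longrightarrow> Y k \<in> measurable N S" shows "hist Y n \<in> measurable N (PiM UNIV (\<lambda>_. S))"
proof (rule measurable_PiM_single')
  have Y: "Y (n - int j) \<in> measurable N S" for j using assms[of "n - int j"] by simp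
  thus "(\<lambda>\<omega>. hist Y n \<omega> j) \<in> measurable N S" for j by (simp add: hist_def)
  show "hist Y n \<in> space N \<rightarrow> (\<Pi>\<^sub>E j\<in>UNIV. space S)"
    using measurable_space[OF Y] by (auto simp: hist_def)
qed

text \<open>The events that agree almost surely with an event of the history form a \<sigma>-field
  containing the generators and the null sets. Completed events are thereby reduced to measurable
  sets of sequences.\<close>

lemma gen_filt_hist:
  assumes Y: "\<And>k. Y k \<in> measurable N S" and A: "A \<in> sets (gen_filt N S Y n)"
  obtains D where "D \<in> sets (PiM UNIV (\<lambda>_::nat. S))" "AE \<omega> in N. \<omega> \<in> A \<longleftrightarrow> hist Y n \<omega> \<in> D"
proof -
  let ?P = "PiM UNIV (\<lambda>_::nat. S)"
  have hist: "hist Y n \<omega> \<in> space ?P" if "\<omega> \<in> space N" for \<omega>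
    using measurable_space[OF measurable_hist that] Y by blast
  have "\<exists>D\<in>sets ?P. AE \<omega> in N. \<omega> \<in> A \<longleftrightarrow> hist Y n \<omega> \<in> D"
    using A unfolding sets_gen_filt
  proof (induction A rule: sigma_sets.induct)
    case (Basic A)
    then consider k B where "A = Y k -` B \<inter> space N" "k \<le> n" "B \<in> sets S" | "A \<in> null_sets (completion N)"
      by blast
    thus ?case
    proof cases
      case 1
      have "{t \<in> space ?P. t (nat (n - k)) \<in> B} \<in> sets ?P" using 1(3) by measurable
      moreover have "AE \<omega> in N. \<omega> \<in> A \<longleftrightarrow> hist Y n \<omega> \<in> {t \<in> space ?P. t (nat (n - k)) \<in> B}"
        using 1 hist by (intro AE_I2) (auto simp: hist_def)
      ultimately show ?thesis by blast
    next
      case 2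
      hence "AE \<omega> in N. \<omega> \<notin> A" using AE_not_in AE_completion_iff by blast
      thus ?thesis by (intro bexI[of _ "{}"]) auto
    qed
  next
    case Empty
    show ?case by (intro bexI[of _ "{}"]) auto
  next
    case (Compl A)
    then obtain D where D: "D \<in> sets ?P" "AE \<omega> in N. \<omega> \<in> A \<longleftrightarrow> hist Y n \<omega> \<in> D" by blast
    have "AE \<omega> in N. \<omega> \<in> space N - A \<longleftrightarrow> hist Y n \<omega> \<in> space ?P - D"
      using D(2) AE_space by eventually_elim (use hist in auto)
    thus ?case using D(1) by blast
  next
    case (Union A)
    then obtain D where D: "\<And>i. D i \<in> sets ?P" "\<And>i::nat. AE \<omega> in N. \<omega> \<in> A i \<longleftrightarrow> hist Y n \<omega> \<in> D i"
      by metis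
    have "AE \<omega> in N. \<forall>i. \<omega> \<in> A i \<longleftrightarrow> hist Y n \<omega> \<in> D i" using D(2) by (simp add: AE_all_countable)
    hence "AE \<omega> in N. \<omega> \<in> (\<Union>i. A i) \<longleftrightarrow> hist Y n \<omega> \<in> (\<Union>i. D i)" by eventually_elim auto
    moreover have "(\<Union>i. D i) \<in> sets ?P" using D(1) by blast
    ultimately show ?case by blast
  qed
  thus ?thesis using that by blast
qed

lemma measure_eqI_PiM_Collect:
  fixes S :: "'s measure"
  assumes sets: "sets P = sets (PiM UNIV (\<lambda>_::'i. S))" "sets Q = sets (PiM UNIV (\<lambda>_. S))"
    and eq: "\<And>J B. finite J \<Longrightarrow> (\<And>j. B j \<in> sets S) \<Longrightarrow>
      emeasure P {t \<in> space P. \<forall>j\<in>J. t j \<in> B j} = emeasure Q {t \<in> space Q. \<forall>j\<in>J. t j \<in> B j}"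
    and fin: "finite_measure P"
  shows "P = Q"
proof (rule measure_eqI_PiM_infinite[OF sets _ fin])
  fix A :: "'i \<Rightarrow> 's set" and J :: "'i set"
  assume J: "finite J" and A: "\<And>i. i \<in> J \<Longrightarrow> A i \<in> sets S"
  have sp: "space P = space (PiM UNIV (\<lambda>_::'i. S))" "space Q = space P"
    using sets sets_eq_imp_space_eq by metis+
  define B where "B j = (if j \<in> J then A j else {})" for j
  have "prod_emb UNIV (\<lambda>_. S) J (Pi\<^sub>E J A) = {t \<in> space P. \<forall>j\<in>J. t j \<in> B j}"
    by (auto simp: prod_emb_def sp space_PiM B_def Pi_iff)
  thus "emeasure P (prod_emb UNIV (\<lambda>_. S) J (Pi\<^sub>E J A)) = emeasure Q (prod_emb UNIV (\<lambda>_. S) J (Pi\<^sub>E J A))"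
    using eq[OF J, of B] A by (simp add: B_def sp)
qed

lemma run_cong: "(\<And>i. i < m \<Longrightarrow> u i = v i) \<Longrightarrow> run F m x u = run F m x v"
proof (induction m arbitrary: x u v)
  case (Suc m)
  have "run F m y (\<lambda>i. u (Suc i)) = run F m y (\<lambda>i. v (Suc i))" for y
    by (rule Suc.IH) (use Suc.prems in auto)
  thus ?case using Suc.prems[of 0] by simp
qed simp

section \<open>Law of the source and restart from an arbitrary past\<close>

context sampled_process
begin

lemma emeasure_U:
  assumes J: "finite J" and B: "\<And>k. B k \<in> sets borel"
  shows "emeasure ext {z \<in> space ext. \<forall>k\<in>J. U k z \<in> B k} = (\<Prod>k\<in>J. emeasure \<mu> (B k))"
proof -
  \<comment> \<open>Any time not after \<open>J\<close> serves; inserting 0 covers empty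
    \<open>J\<close>.\<close>
  define s where "s = Min (insert 0 J)"
  have "past X s -` UNIV \<inter> space M = space M" by simp
  thus ?thesis
    using emeasure_past_U[OF J, of s UNIV B] J B X.emeasure_space_1 sets.top[of past_space]
    by (auto simp: s_def)
qed

lemma distr_U: "distr ext borel (U n) = \<mu>"
proof (rule measure_eqI)
  fix B assume B: "B \<in> sets (distr ext borel (U n))"
  hence "emeasure (distr ext borel (U n)) B = emeasure ext {z \<in> space ext. U n z \<in> B}"
    by (subst emeasure_distr) (auto intro!: arg_cong[where f = "emeasure ext"])
  thus "emeasure (distr ext borel (U n)) B = emeasure \<mu> B"
    using emeasure_U[of "{n}" "\<lambda>_. B"] B by simp
qed (simp add: sets_law)

lemma indep_vars_U: "prob_space.indep_vars ext (\<lambda>_. borel) U UNIV"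
proof -
  interpret E: prob_space ext by (rule prob_space_ext)
  interpret Q: product_prob_space "\<lambda>_::int. \<mu>" UNIV ..
  have [measurable]: "(\<lambda>z i. U i z) \<in> measurable ext (PiM UNIV (\<lambda>_::int. borel))"
    by (rule measurable_PiM_single') auto
  have sets_Q: "sets (PiM UNIV (\<lambda>_::int. \<mu>)) = sets (PiM UNIV (\<lambda>_::int. borel))"
    by (intro sets_PiM_cong) (auto simp: sets_law)
  have "distr ext (PiM UNIV (\<lambda>_::int. borel)) (\<lambda>z i. U i z) = PiM UNIV (\<lambda>_::int. \<mu>)"
  proof (rule measure_eqI_PiM_Collect)
    fix J :: "int set" and B :: "int \<Rightarrow> real set" assume J: "finite J" and B: "\<And>j. B j \<in> sets borel"
    have "{t \<in> space (PiM UNIV (\<lambda>_::int. borel)). \<forall>j\<in>J. t j \<in> B j} \<in> sets (PiM UNIV (\<lambda>_::int. borel :: real measure))"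
      using J B by measurable
    hence "emeasure (distr ext (PiM UNIV (\<lambda>_::int. borel)) (\<lambda>z i. U i z))
        {t \<in> space (PiM UNIV (\<lambda>_::int. borel)). \<forall>j\<in>J. t j \<in> B j} =
        emeasure ext {z \<in> space ext. \<forall>k\<in>J. U k z \<in> B k}"
      by (subst emeasure_distr) (auto simp: space_PiM intro!: arg_cong[where f = "emeasure ext"])
    thus "emeasure (distr ext (PiM UNIV (\<lambda>_::int. borel)) (\<lambda>z i. U i z))
        {t \<in> space (distr ext (PiM UNIV (\<lambda>_::int. borel)) (\<lambda>z i. U i z)). \<forall>j\<in>J. t j \<in> B j} =
        emeasure (PiM UNIV (\<lambda>_::int. \<mu>)) {t \<in> space (PiM UNIV (\<lambda>_::int. \<mu>)). \<forall>j\<in>J. t j \<in> B j}"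
      using emeasure_U[OF J B] Q.emeasure_PiM_Collect[of J B] J B by (simp add: sets_law)
  next
    show "finite_measure (distr ext (PiM UNIV (\<lambda>_::int. borel)) (\<lambda>z i. U i z))"
      by (rule prob_space.finite_measure) (rule E.prob_space_distr, measurable)
  qed (simp_all add: sets_Q)
  thus ?thesis by (subst E.indep_vars_iff_distr_eq_PiM) (auto simp: distr_U restrict_UNIV)
qed

lemma distr_past_U:
  "distr ext (past_space \<Otimes>\<^sub>M PiM UNIV (\<lambda>_. borel)) (\<lambda>z. (past X s (fst z), \<lambda>j::nat. U (s + int j) z)) =
    distr M past_space (past X s) \<Otimes>\<^sub>M seq.S"
proof -
  let ?B = "PiM UNIV (\<lambda>_::nat. borel :: real measure)"
  let ?V = "\<lambda>z (j::nat). U (s + int j) z"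
  interpret E: prob_space ext by (rule prob_space_ext)
  interpret P: prob_space "distr M past_space (past X s)" by (rule X.prob_space_distr) measurable
  have V [measurable]: "?V \<in> measurable ext ?B" by (rule measurable_PiM_single') auto
  have [measurable]: "(\<lambda>z. past X s (fst z)) \<in> measurable ext past_space" by measurable
  show ?thesis
  proof (rule pair_measure_eqI[symmetric])
    show "sigma_finite_measure (distr M past_space (past X s))" by unfold_locales
    show "sigma_finite_measure seq.S" by unfold_locales
    show "sets (distr M past_space (past X s) \<Otimes>\<^sub>M seq.S) =
        sets (distr ext (past_space \<Otimes>\<^sub>M ?B) (\<lambda>z. (past X s (fst z), ?V z)))"
      by (simp add: sets_seq cong: sets_pair_measure_cong)
    fix A D assume "A \<in> sets (distr M past_space (past X s))" and D: "D \<in> sets seq.S"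
    hence A [measurable]: "A \<in> sets past_space" by simp
    have D' [measurable]: "D \<in> sets ?B" using D by (simp add: sets_seq)
    define C where "C = {z \<in> space ext. past X s (fst z) \<in> A}"
    have C [measurable]: "C \<in> sets ext" unfolding C_def by measurable
    \<comment> \<open>With the event on the past frozen as a density, the joint law becomes an
      equality of two finite measures on sequences, which is checked on cylinders.\<close>
    have eq: "distr (density ext (indicator C)) ?B ?V = scale_measure (emeasure M (past X s -` A \<inter> space M)) seq.S"
    proof (rule measure_eqI_PiM_Collect)
      fix J :: "nat set" and B :: "nat \<Rightarrow> real set" assume J: "finite J" and B: "\<And>j. B j \<in> sets borel"
      have m: "{t \<in> space ?B. \<forall>j\<in>J. t j \<in> B j} \<in> sets ?B" using J B by measurable
      have m2: "{z \<in> space ext. \<forall>j\<in>J. ?V z j \<in> B j} \<in> sets ext" using J B by measurable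
      have "emeasure (distr (density ext (indicator C)) ?B ?V) {t \<in> space ?B. \<forall>j\<in>J. t j \<in> B j} =
          emeasure (density ext (indicator C)) {z \<in> space ext. \<forall>j\<in>J. ?V z j \<in> B j}"
        using m by (subst emeasure_distr) (auto simp: space_PiM intro!: arg_cong[where f = "emeasure (density ext (indicator C))"])
      also have "\<dots> = emeasure ext (C \<inter> {z \<in> space ext. \<forall>j\<in>J. ?V z j \<in> B j})"
        by (rule emeasure_restricted[OF C m2])
      also have "C \<inter> {z \<in> space ext. \<forall>j\<in>J. ?V z j \<in> B j} =
          {z \<in> space ext. past X s (fst z) \<in> A \<and> (\<forall>k\<in>(\<lambda>j. s + int j) ` J. U k z \<in> B (nat (k - s)))}"
        by (auto simp: C_def)
      also have "emeasure ext \<dots> = emeasure M (past X s -` A \<inter> space M) *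
          (\<Prod>k\<in>(\<lambda>j. s + int j) ` J. emeasure \<mu> (B (nat (k - s))))"
        by (rule emeasure_past_U) (use J B in auto)
      also have "(\<Prod>k\<in>(\<lambda>j. s + int j) ` J. emeasure \<mu> (B (nat (k - s)))) = (\<Prod>j\<in>J. emeasure \<mu> (B j))"
        by (subst prod.reindex) (auto simp: inj_on_def)
      also have "(\<Prod>j\<in>J. emeasure \<mu> (B j)) = emeasure seq.S {t \<in> space seq.S. \<forall>j\<in>J. t j \<in> B j}"
        by (rule seq.emeasure_PiM_Collect[symmetric]) (use J B in \<open>auto simp: sets_law\<close>)
      finally show "emeasure (distr (density ext (indicator C)) ?B ?V)
          {t \<in> space (distr (density ext (indicator C)) ?B ?V). \<forall>j\<in>J. t j \<in> B j} =
        emeasure (scale_measure (emeasure M (past X s -` A \<inter> space M)) seq.S)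
          {t \<in> space (scale_measure (emeasure M (past X s -` A \<inter> space M)) seq.S). \<forall>j\<in>J. t j \<in> B j}"
        by (simp only: space_distr space_scale_measure emeasure_scale_measure)
    next
      show "finite_measure (distr (density ext (indicator C)) ?B ?V)"
      proof (rule finite_measure.finite_measure_distr)
        have "emeasure (density ext (indicator C)) (space ext) = emeasure ext C"
          by (subst emeasure_restricted) (auto simp: C_def intro!: arg_cong[where f = "emeasure ext"])
        thus "finite_measure (density ext (indicator C))" by (intro finite_measureI) simp
      qed simp
    qed (simp_all add: sets_seq)
    have "emeasure (distr M past_space (past X s)) A * emeasure seq.S D =
        emeasure (scale_measure (emeasure M (past X s -` A \<inter> space M)) seq.S) D"
      by (simp add: emeasure_distr)
    also have "\<dots> = emeasure (density ext (indicator C)) (?V -` D \<inter> space ext)"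
      unfolding eq[symmetric] by (simp add: emeasure_distr)
    also have "\<dots> = emeasure ext (C \<inter> (?V -` D \<inter> space ext))"
      by (rule emeasure_restricted[OF C measurable_sets[OF V D']])
    also have "C \<inter> (?V -` D \<inter> space ext) = (\<lambda>z. (past X s (fst z), ?V z)) -` (A \<times> D) \<inter> space ext"
      by (auto simp: C_def)
    also have "emeasure ext \<dots> = emeasure (distr ext (past_space \<Otimes>\<^sub>M ?B) (\<lambda>z. (past X s (fst z), ?V z))) (A \<times> D)"
      by (rule emeasure_distr[symmetric]) auto
    finally show "emeasure (distr M past_space (past X s)) A * emeasure seq.S D =
      emeasure (distr ext (past_space \<Otimes>\<^sub>M ?B) (\<lambda>z. (past X s (fst z), ?V z))) (A \<times> D)" .
  qed
qed

lemma AE_run: "AE z in ext. \<forall>s m. run F m (past X s (fst z)) (\<lambda>j. U (s + int j) z) = past X (s + int m) (fst z)"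
proof -
  have "AE z in ext. \<forall>n. F (past X n (fst z)) (U n z) = X n (fst z)"
    by (simp add: AE_all_countable AE_sample_U)
  thus ?thesis
  proof eventually_elim
    case (elim z)
    have "run F m (past X s (fst z)) (\<lambda>j. U (s + int j) z) = past X (s + int m) (fst z)" for s m
    proof (induction m arbitrary: s)
      case (Suc m)
      show ?case using Suc[of "s + 1"] elim by (simp add: past_Suc[symmetric] algebra_simps)
    qed simp
    thus ?case by blast
  qed
qed

text \<open>Run from the true past with the true inputs, the recursion returns \<open>X n\<close>.
  The true past is independent of these inputs, so \<open>run_gap\<close> at agreement level 0 can
  be integrated over it.\<close>

lemma run_mismatch:
  assumes c: "0 \<le> c" "c * delta p 0 \<le> 1"
  shows "{z \<in> space ext. X n (fst z) \<noteq> run F m x (\<lambda>j. U (n + 1 - int m + int j) z) 0} \<in> sets ext"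
    and "measure ext {z \<in> space ext. X n (fst z) \<noteq> run F m x (\<lambda>j. U (n + 1 - int m + int j) z) 0}
      \<le> hit (\<lambda>l. 1 - c * delta p l) m 0"
proof -
  let ?B = "PiM UNIV (\<lambda>_::nat. borel :: real measure)"
  \<comment> \<open>The \<open>m\<close> steps at times \<open>s\<close>, ..., \<open>n\<close> end
    with the letter of time \<open>n\<close> at index 0.\<close>
  define s where "s = n + 1 - int m"
  let ?V = "\<lambda>z (j::nat). U (s + int j) z"
  interpret E: prob_space ext by (rule prob_space_ext)
  interpret P: prob_space "distr M past_space (past X s)" by (rule X.prob_space_distr) measurable
  have V [measurable]: "?V \<in> measurable ext ?B" by (rule measurable_PiM_single') auto
  have [measurable]: "(\<lambda>z. past X s (fst z)) \<in> measurable ext past_space" by measurable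
  show meas: "{z \<in> space ext. X n (fst z) \<noteq> run F m x (\<lambda>j. U (n + 1 - int m + int j) z) 0} \<in> sets ext"
    unfolding s_def[symmetric] by measurable
  define W where "W = {w \<in> space (past_space \<Otimes>\<^sub>M ?B). run F m (fst w) (snd w) 0 \<noteq> run F m x (snd w) 0}"
  have W [measurable]: "W \<in> sets (past_space \<Otimes>\<^sub>M ?B)"
    unfolding W_def by measurable
  have "AE z in ext. X n (fst z) = run F m (past X s (fst z)) (?V z) 0"
    using AE_run by eventually_elim (simp add: s_def past_def)
  hence "emeasure ext {z \<in> space ext. X n (fst z) \<noteq> run F m x (\<lambda>j. U (n + 1 - int m + int j) z) 0} =
      emeasure ext ((\<lambda>z. (past X s (fst z), ?V z)) -` W \<inter> space ext)"
  proof (intro emeasure_eq_AE meas)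
    show "(\<lambda>z. (past X s (fst z), ?V z)) -` W \<inter> space ext \<in> sets ext" by measurable
  qed (auto simp: W_def space_pair_measure space_PiM s_def)
  also have "\<dots> = emeasure (distr M past_space (past X s) \<Otimes>\<^sub>M seq.S) W"
    unfolding distr_past_U[symmetric] by (rule emeasure_distr[symmetric]) auto
  also have "\<dots> = (\<integral>\<^sup>+y. emeasure seq.S (Pair y -` W) \<partial>distr M past_space (past X s))"
    by (rule seq.emeasure_pair_measure_alt) (use W in \<open>simp add: sets_seq cong: sets_pair_measure_cong\<close>)
  also have "\<dots> \<le> (\<integral>\<^sup>+y. ennreal (hit (\<lambda>l. 1 - c * delta p l) m 0) \<partial>distr M past_space (past X s))"
  proof (intro nn_integral_mono)
    fix y
    have "Pair y -` W = {u. run F m y u 0 \<noteq> run F m x u 0}"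
      by (auto simp: W_def space_pair_measure space_PiM)
    thus "emeasure seq.S (Pair y -` W) \<le> ennreal (hit (\<lambda>l. 1 - c * delta p l) m 0)"
      using run_gap[OF cond_law_axioms c, of 0 y x m] by (simp add: seq.emeasure_eq_measure ennreal_leI)
  qed
  also have "\<dots> = ennreal (hit (\<lambda>l. 1 - c * delta p l) m 0)"
    by (simp add: P.emeasure_space_1[simplified])
  finally show "measure ext {z \<in> space ext. X n (fst z) \<noteq> run F m x (\<lambda>j. U (n + 1 - int m + int j) z) 0}
      \<le> hit (\<lambda>l. 1 - c * delta p l) m 0"
    using run_gap[OF cond_law_axioms c, of 0 x x m]
    by (simp add: E.emeasure_eq_measure)
qed

end

section \<open>Immersion\<close>

context sampled_process
begin

abbreviation lift_X :: "int \<Rightarrow> 'w \<times> (int \<Rightarrow> real) \<Rightarrow> 'a" where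
  "lift_X n z \<equiv> X n (fst z)"

abbreviation G_X :: "int \<Rightarrow> ('w \<times> (int \<Rightarrow> real)) measure" where
  "G_X \<equiv> gen_filt ext (count_space UNIV) lift_X"

abbreviation G_U :: "int \<Rightarrow> ('w \<times> (int \<Rightarrow> real)) measure" where
  "G_U \<equiv> gen_filt ext borel U"

lemma adapted:
  assumes c: "0 \<le> c" "c * delta p 0 \<le> 1"
    and div: "filterlim (\<lambda>K. \<Sum>k\<le>K. \<Prod>n\<le>k. 1 - c * delta p n) at_top sequentially"
  shows "{z \<in> space ext. X n (fst z) = a} \<in> sets (G_U n)"
proof -
  interpret E: prob_space ext by (rule prob_space_ext)
  let ?r = "\<lambda>l. 1 - c * delta p l"
  have r: "0 \<le> ?r l" "?r l \<le> 1" for l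
  proof -
    have "c * delta p l \<le> c * delta p 0"
      using c decseqD[OF decseq_delta, of 0 l] by (intro mult_left_mono) auto
    thus "0 \<le> ?r l" using c by simp
    show "?r l \<le> 1" using c delta_nonneg by simp
  qed
  have r_mono: "incseq ?r"
    using c decseqD[OF decseq_delta] by (auto simp: incseq_def intro!: mult_left_mono)
  have lim: "(\<lambda>m. hit ?r m 0) \<longlonglongrightarrow> 0" by (rule hit_tendsto_zero[OF r r_mono div])
  have "\<exists>m. hit ?r m 0 < (1/2) ^ i" for i :: nat
    using order_tendstoD(2)[OF lim, of "(1/2) ^ i"] by (auto simp: eventually_sequentially)
  \<comment> \<open>Convergence to 0 has no rate; a subsequence makes the mismatch probabilities
    summable.\<close>
  then obtain m where m: "\<And>i. hit ?r (m i) 0 < (1/2) ^ i" by metis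
  \<comment> \<open>\<open>undefined\<close> is an arbitrary fixed past.\<close>
  define Z where "Z i z = run F (m i) undefined (\<lambda>j. U (n + 1 - int (m i) + int j) z) 0" for i z
  have Z_meas: "Z i \<in> measurable (G_U n) (count_space UNIV)" for i
  proof -
    \<comment> \<open>Inputs after time \<open>n\<close> are replaced by 0 to stay within
      \<open>G_U n\<close>; by \<open>run_cong\<close> the first \<open>m i\<close> inputs alone
      matter.\<close>
    let ?u = "\<lambda>z j. if j < m i then U (n + 1 - int (m i) + int j) z else 0"
    have "(\<lambda>z. ?u z j) \<in> borel_measurable (G_U n)" for j
    proof (cases "j < m i")
      case True
      have "U (n + 1 - int (m i) + int j) \<in> borel_measurable (G_U n)"
        by (rule measurable_gen_filt) (use True in auto)
      thus ?thesis using True by simp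
    qed simp
    hence u: "?u \<in> measurable (G_U n) (PiM UNIV (\<lambda>_::nat. borel))"
      by (intro measurable_PiM_single') auto
    have "(\<lambda>z. run F (m i) undefined (?u z)) \<in> measurable (G_U n) past_space"
      by (rule measurable_run[OF _ u]) simp
    hence "(\<lambda>z. run F (m i) undefined (?u z) 0) \<in> measurable (G_U n) (count_space UNIV)"
      by (rule measurable_past_nth)
    moreover have "run F (m i) undefined (?u z) = run F (m i) undefined (\<lambda>j. U (n + 1 - int (m i) + int j) z)" for z
      by (rule run_cong) simp
    ultimately show ?thesis unfolding Z_def by simp
  qed
  define B where "B i = {z \<in> space ext. X n (fst z) \<noteq> Z i z}" for i
  have B: "B i \<in> sets ext" "measure ext (B i) \<le> (1/2) ^ i" for i
    using run_mismatch[OF c, of n "m i" undefined] m[of i] by (auto simp: B_def Z_def)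
  have "AE z in ext. eventually (\<lambda>i. z \<in> space ext - B i) sequentially"
  proof (rule borel_cantelli_AE1)
    show "summable (\<lambda>i. measure ext (B i))"
      by (rule summable_comparison_test'[where g = "\<lambda>i. (1/2::real) ^ i" and N = 0]) (use B in auto)
  qed (use B in \<open>auto simp: E.emeasure_eq_measure\<close>)
  hence AE: "AE z in ext. z \<in> {z \<in> space ext. \<exists>k. \<forall>i\<in>{k..}. Z i z = a} \<longleftrightarrow> z \<in> {z \<in> space ext. X n (fst z) = a}"
    using AE_space
  proof eventually_elim
    case (elim z)
    then obtain k where k: "\<And>i. i \<ge> k \<Longrightarrow> Z i z = X n (fst z)"
      by (auto simp: eventually_sequentially B_def) metis
    have "X n (fst z) = a" if "\<forall>i\<in>{l..}. Z i z = a" for l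
      using that k[of "max k l"] by auto
    thus ?case using elim k by auto
  qed
  have "{z \<in> space ext. \<exists>k. \<forall>i\<in>{k..}. Z i z = a} \<in> sets (G_U n)"
  proof -
    note [measurable] = Z_meas
    have "{z \<in> space (G_U n). \<exists>k. \<forall>i\<in>{k..}. Z i z = a} \<in> sets (G_U n)" by measurable
    thus ?thesis by simp
  qed
  thus ?thesis by (rule gen_filt_AE_cong[OF _ _ AE]) blast
qed

lemma lift_X_measurable: "lift_X n \<in> measurable ext (count_space UNIV)"
  by measurable

lemma G_X_subset_G_U:
  assumes "\<And>n a. {z \<in> space ext. X n (fst z) = a} \<in> sets (G_U n)"
  shows "sets (G_X n) \<subseteq> sets (G_U n)"
proof -
  have "lift_X k -` B \<inter> space ext \<in> sets (G_U n)" if "k \<le> n" for k and B :: "'a set"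
  proof -
    have "lift_X k -` B \<inter> space ext = (\<Union>a\<in>B. {z \<in> space ext. X k (fst z) = a})" by auto
    moreover have "{z \<in> space ext. X k (fst z) = a} \<in> sets (G_U n)" for a
      using assms[of k a] gen_filt_mono[OF that, of ext borel U] by blast
    ultimately show ?thesis by (auto intro!: sets.finite_UN)
  qed
  hence "{lift_X k -` B \<inter> space ext | k B. k \<le> n \<and> B \<in> sets (count_space UNIV)} \<union> null_sets (completion ext)
      \<subseteq> sets (G_U n)"
    using gen_filt_null[of _ ext borel U n] by blast
  thus ?thesis
    unfolding sets_gen_filt[of ext "count_space UNIV"]
    by (rule sets.sigma_sets_subset[of _ "G_U n", simplified])
qed

text \<open>On a cylinder, integrating out the auxiliary coordinates turns the constraints on the
  source up to \<open>n\<close> into a function of \<open>past X (n + 1)\<close>, to which the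
  conditional law of the next letter applies. Uniqueness of finite measures gives all
  \<open>D\<close>.\<close>

lemma nn_integral_next_letter:
  assumes D: "D \<in> sets (PiM UNIV (\<lambda>_::nat. borel))"
  shows "(\<integral>\<^sup>+z. indicator {a} (X (n + 1) (fst z)) * indicator D (hist U n z) \<partial>ext) =
    (\<integral>\<^sup>+z. ennreal (p (past X (n + 1) (fst z)) a) * indicator D (hist U n z) \<partial>ext)"
proof -
  interpret E: prob_space ext by (rule prob_space_ext)
  let ?B = "PiM UNIV (\<lambda>_::nat. borel :: real measure)"
  have h [measurable]: "hist U n \<in> measurable ext ?B" by (rule measurable_hist) measurable
  let ?P = "distr (density ext (\<lambda>z. indicator {a} (X (n + 1) (fst z)))) ?B (hist U n)"
  let ?Q = "distr (density ext (\<lambda>z. ennreal (p (past X (n + 1) (fst z)) a))) ?B (hist U n)"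
  have P: "emeasure ?P D = (\<integral>\<^sup>+z. indicator {a} (X (n + 1) (fst z)) * indicator D (hist U n z) \<partial>ext)"
    if [measurable]: "D \<in> sets ?B" for D
    by (simp add: emeasure_distr emeasure_density, intro nn_integral_cong) (auto split: split_indicator)
  have Q: "emeasure ?Q D = (\<integral>\<^sup>+z. ennreal (p (past X (n + 1) (fst z)) a) * indicator D (hist U n z) \<partial>ext)"
    if [measurable]: "D \<in> sets ?B" for D
    by (simp add: emeasure_distr emeasure_density, intro nn_integral_cong) (auto split: split_indicator)
  have "?P = ?Q"
  proof (rule measure_eqI_PiM_Collect)
    fix J :: "nat set" and B :: "nat \<Rightarrow> real set" assume J: "finite J" and B: "\<And>j. B j \<in> sets borel"
    let ?J = "(\<lambda>j. n - int j) ` J" and ?B' = "\<lambda>k. B (nat (n - k))"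
    have D: "{t \<in> space ?B. \<forall>j\<in>J. t j \<in> B j} \<in> sets ?B" using J B by measurable
    have ind: "indicator {t \<in> space ?B. \<forall>j\<in>J. t j \<in> B j} (hist U n z) = (\<Prod>k\<in>?J. indicator (?B' k) (U k z) :: ennreal)" for z
    proof -
      have "(\<Prod>k\<in>?J. indicator (?B' k) (U k z) :: ennreal) = (\<Prod>j\<in>J. indicator (B j) (hist U n z j))"
        by (subst prod.reindex) (auto simp: inj_on_def hist_def)
      also have "\<dots> = indicator {t \<in> space ?B. \<forall>j\<in>J. t j \<in> B j} (hist U n z)"
        using J by (induction J) (auto simp: space_PiM split: split_indicator)
      finally show ?thesis by simp
    qed
    obtain g where [measurable]: "g \<in> borel_measurable past_space"
      and g: "\<And>\<omega>. (\<Prod>k\<in>?J. kern (?B' k) (past X k \<omega>) (X k \<omega>)) = g (past X (n + 1) \<omega>)"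
    proof (rule kern_prod_past[of ?J "n + 1" ?B'])
      show "finite ?J" using J by simp
      show "k < n + 1" if "k \<in> ?J" for k using that by auto
      show "?B' k \<in> sets borel" for k by (rule B)
    qed blast
    have "emeasure ?P {t \<in> space ?B. \<forall>j\<in>J. t j \<in> B j} =
        (\<integral>\<^sup>+z. indicator {a} (X (n + 1) (fst z)) * (\<Prod>k\<in>?J. indicator (?B' k) (U k z)) \<partial>ext)"
      unfolding P[OF D] ind ..
    also have "\<dots> = (\<integral>\<^sup>+\<omega>. indicator {a} (X (n + 1) \<omega>) * g (past X (n + 1) \<omega>) \<partial>M)"
      unfolding g[symmetric] by (rule nn_integral_ext) (use J B in auto)
    also have "\<dots> = (\<integral>\<^sup>+\<omega>. ennreal (p (past X (n + 1) \<omega>) a) * g (past X (n + 1) \<omega>) \<partial>M)"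
      by (rule nn_integral_cond_law) measurable
    also have "\<dots> = (\<integral>\<^sup>+z. ennreal (p (past X (n + 1) (fst z)) a) * (\<Prod>k\<in>?J. indicator (?B' k) (U k z)) \<partial>ext)"
      unfolding g[symmetric] by (rule nn_integral_ext[symmetric]) (use J B in auto)
    also have "\<dots> = emeasure ?Q {t \<in> space ?B. \<forall>j\<in>J. t j \<in> B j}"
      unfolding Q[OF D] ind ..
    finally show "emeasure ?P {t \<in> space ?P. \<forall>j\<in>J. t j \<in> B j} = emeasure ?Q {t \<in> space ?Q. \<forall>j\<in>J. t j \<in> B j}"
      by (simp only: space_distr)
  next
    have "emeasure ?P (space ?P) \<le> (\<integral>\<^sup>+z. 1 \<partial>ext)"
      unfolding space_distr P[OF sets.top] by (intro nn_integral_mono) (auto split: split_indicator)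
    hence "emeasure ?P (space ?P) < \<infinity>" using E.emeasure_space_1 by (simp add: order_le_less_trans)
    thus "finite_measure ?P" by (intro finite_measureI) auto
  qed simp_all
  thus ?thesis using P[OF D] Q[OF D] by simp
qed

lemma integral_next_letter:
  assumes C: "C \<in> sets (G_U n)"
  shows "(\<integral>z. indicator C z * indicator {a} (X (n + 1) (fst z)) \<partial>completion ext) =
    (\<integral>z. indicator C z * p (past X (n + 1) (fst z)) a \<partial>completion ext)"
proof -
  interpret E: prob_space ext by (rule prob_space_ext)
  let ?B = "PiM UNIV (\<lambda>_::nat. borel :: real measure)"
  have h [measurable]: "hist U n \<in> measurable ext ?B" by (rule measurable_hist) measurable
  have sub: "sets (G_U n) \<subseteq> sets (completion ext)"
    using subalgebra_gen_filt[of U ext borel n] by (simp add: subalgebra_def)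
  have [measurable]: "C \<in> sets (completion ext)" using C sub by blast
  obtain D where D [measurable]: "D \<in> sets ?B" and AE: "AE z in ext. z \<in> C \<longleftrightarrow> hist U n z \<in> D"
    using gen_filt_hist[of U ext borel C n] C by auto
  have swap: "(\<integral>z. indicator C z * f z \<partial>completion ext) = (\<integral>z. indicator D (hist U n z) * f z \<partial>ext)"
    if [measurable]: "f \<in> borel_measurable ext" for f :: "_ \<Rightarrow> real"
  proof -
    have [measurable]: "f \<in> borel_measurable (completion ext)" by (rule measurable_completion) measurable
    have m: "(\<lambda>z. indicator D (hist U n z) * f z) \<in> borel_measurable ext" by measurable
    hence [measurable]: "(\<lambda>z. indicator D (hist U n z) * f z) \<in> borel_measurable (completion ext)"
      by (rule measurable_completion)
    have "(\<integral>z. indicator C z * f z \<partial>completion ext) = (\<integral>z. indicator D (hist U n z) * f z \<partial>completion ext)"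
    proof (rule integral_cong_AE)
      show "AE z in completion ext. indicator C z * f z = indicator D (hist U n z) * f z"
        unfolding AE_completion_iff using AE by eventually_elim (auto split: split_indicator)
    qed measurable
    thus ?thesis using integral_completion[OF m] by simp
  qed
  have "(\<integral>z. indicator D (hist U n z) * indicator {a} (X (n + 1) (fst z)) \<partial>ext) =
      (\<integral>z. indicator D (hist U n z) * p (past X (n + 1) (fst z)) a \<partial>ext)"
  proof -
    have "(\<integral>z. indicator D (hist U n z) * indicator {a} (X (n + 1) (fst z)) \<partial>ext) =
        enn2real (\<integral>\<^sup>+z. indicator {a} (X (n + 1) (fst z)) * indicator D (hist U n z) \<partial>ext)"
      by (subst integral_eq_nn_integral)
        (auto intro!: arg_cong[where f = enn2real] nn_integral_cong split: split_indicator)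
    also have "\<dots> = enn2real (\<integral>\<^sup>+z. ennreal (p (past X (n + 1) (fst z)) a) * indicator D (hist U n z) \<partial>ext)"
      by (simp only: nn_integral_next_letter[OF D])
    also have "\<dots> = (\<integral>z. indicator D (hist U n z) * p (past X (n + 1) (fst z)) a \<partial>ext)"
      by (subst integral_eq_nn_integral)
        (auto intro!: arg_cong[where f = enn2real] nn_integral_cong simp: nonneg split: split_indicator)
    finally show ?thesis .
  qed
  thus ?thesis by (subst (1 2) swap) auto
qed

text \<open>Past and next letter determine \<open>G_X (n + 1)\<close>, so its events are unions of
  \<open>A' a \<inter> {X (n + 1) = a}\<close>.\<close>

lemma G_X_next:
  assumes "A \<in> sets (G_X (n + 1))"
  obtains A' where "\<And>a. A' a \<in> sets (G_X n)" "A = {z \<in> space ext. z \<in> A' (X (n + 1) (fst z))}"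
proof -
  have "\<exists>A'. (\<forall>a. A' a \<in> sets (G_X n)) \<and> A = {z \<in> space ext. z \<in> A' (X (n + 1) (fst z))}"
    using assms unfolding sets_gen_filt[of ext "count_space UNIV" lift_X "n + 1"]
  proof (induction A rule: sigma_sets.induct)
    case (Basic A)
    then consider k B where "A = lift_X k -` B \<inter> space ext" "k \<le> n"
      | B where "A = lift_X (n + 1) -` B \<inter> space ext" | "A \<in> null_sets (completion ext)"
      by (auto simp: le_less)
    thus ?case
    proof cases
      case 1
      have "A \<in> sets (G_X n)"
        unfolding 1 using measurable_sets[OF measurable_gen_filt[of lift_X k ext "count_space UNIV" n], of B] 1
        by (simp add: lift_X_measurable)
      moreover have "A \<subseteq> space ext" using 1 by auto
      ultimately show ?thesis by (intro exI[of _ "\<lambda>_. A"]) auto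
    next
      case 2
      show ?thesis
      proof (intro exI[of _ "\<lambda>a. if a \<in> B then space ext else {}"] conjI allI)
        show "(if a \<in> B then space ext else {}) \<in> sets (G_X n)" for a
          using sets.top[of "G_X n"] by simp
      qed (auto simp: 2 split: if_splits)
    next
      case 3
      have "A \<subseteq> space ext" using 3 sets.sets_into_space[of A "completion ext"] by (auto simp: null_sets_def)
      thus ?thesis using gen_filt_null[OF 3] by (intro exI[of _ "\<lambda>_. A"]) auto
    qed
  next
    case Empty
    show ?case by (intro exI[of _ "\<lambda>_. {}"]) auto
  next
    case (Compl A)
    then obtain A' where A': "\<And>a. A' a \<in> sets (G_X n)" "A = {z \<in> space ext. z \<in> A' (X (n + 1) (fst z))}" by blast
    have "space (G_X n) - A' a \<in> sets (G_X n)" for a by (rule sets.compl_sets) (rule A')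
    thus ?case using A'(2) by (intro exI[of _ "\<lambda>a. space ext - A' a"]) auto
  next
    case (Union A)
    have "\<forall>i. \<exists>A'. (\<forall>a. A' a \<in> sets (G_X n)) \<and> A i = {z \<in> space ext. z \<in> A' (X (n + 1) (fst z))}"
      by (intro allI Union.IH)
    from choice[OF this] obtain A'
      where ex: "\<forall>i. (\<forall>a. A' i a \<in> sets (G_X n)) \<and> A i = {z \<in> space ext. z \<in> A' i (X (n + 1) (fst z))}" ..
    have A': "A' i a \<in> sets (G_X n)" "A i = {z \<in> space ext. z \<in> A' i (X (n + 1) (fst z))}" for i a
      using spec[OF ex, of i] by (blast, elim conjE)
    show ?case
    proof (intro exI[of _ "\<lambda>a. \<Union>i. A' i a"] conjI allI)
      show "(\<Union>i. A' i a) \<in> sets (G_X n)" for a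
        by (intro sets.countable_UN image_subsetI A'(1))
      show "(\<Union>i. A i) = {z \<in> space ext. z \<in> (\<Union>i. A' i (X (n + 1) (fst z)))}"
        unfolding A'(2) by blast
    qed
  qed
  thus ?thesis using that by blast
qed

text \<open>The conditional probability of \<open>A\<close> given \<open>G_U n\<close> is
  \<open>g\<close>, the average of the pieces \<open>A' a\<close> with weights given by
  \<open>p\<close>. Since \<open>g\<close> is already \<open>G_X n\<close>-measurable, it factors
  out of the conditional expectation of the indicator of \<open>A \<inter> B\<close>.\<close>

lemma cond_indep:
  assumes sub: "\<And>n. sets (G_X n) \<subseteq> sets (G_U n)"
  shows "cond_indep_given (completion ext) (G_X (n + 1)) (G_U n) (G_X n)"
  unfolding cond_indep_given_def
proof (intro ballI)
  fix A B assume A: "A \<in> sets (G_X (n + 1))" and B: "B \<in> sets (G_U n)"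
  interpret E: prob_space ext by (rule prob_space_ext)
  interpret C: prob_space "completion ext" by (rule E.prob_space_completion)
  have GX: "subalgebra (completion ext) (G_X n)" for n
    by (rule subalgebra_gen_filt) (rule lift_X_measurable)
  interpret S: finite_measure_subalgebra "completion ext" "G_X n"
    by unfold_locales (rule GX)
  have GU: "sets (G_U n) \<subseteq> sets (completion ext)"
    using subalgebra_gen_filt[of U ext borel n] by (simp add: subalgebra_def)
  have mA [measurable]: "A \<in> sets (completion ext)" using A GX[of "n + 1"] by (auto simp: subalgebra_def)
  have mB [measurable]: "B \<in> sets (completion ext)" using B GU by auto
  have le: "p x a \<le> 1" for x a
    using member_le_sum[of a UNIV "p x"] nonneg sum1[of x] by auto
  obtain A' where A': "\<And>a. A' a \<in> sets (G_X n)" "A = {z \<in> space ext. z \<in> A' (X (n + 1) (fst z))}"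
    using G_X_next[OF A] by blast
  have mA' [measurable]: "A' a \<in> sets (completion ext)" for a
    using A'(1)[of a] GX[of n] by (auto simp: subalgebra_def)
  define g where "g z = (\<Sum>a\<in>UNIV. indicator (A' a) z * p (past X (n + 1) (fst z)) a)" for z
  have g_GX: "g \<in> borel_measurable (G_X n)"
  proof -
    have [measurable]: "(\<lambda>z. past X (n + 1) (fst z)) \<in> measurable (G_X n) past_space"
    proof (rule measurable_past_spaceI)
      fix m
      have "lift_X (n - int m) \<in> measurable (G_X n) (count_space UNIV)"
        by (rule measurable_gen_filt[OF lift_X_measurable]) simp
      thus "(\<lambda>z. past X (n + 1) (fst z) m) \<in> measurable (G_X n) (count_space UNIV)"
        by (simp add: past_def)
    qed
    note [measurable] = A'(1)
    show ?thesis unfolding g_def by measurable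
  qed
  hence g [measurable]: "g \<in> borel_measurable (completion ext)"
    by (rule measurable_from_subalg[OF GX])
  have g01: "0 \<le> g z" "g z \<le> 1" for z
  proof -
    show "0 \<le> g z" unfolding g_def by (simp add: sum_nonneg nonneg)
    have "g z \<le> (\<Sum>a\<in>UNIV. p (past X (n + 1) (fst z)) a)"
      unfolding g_def by (intro sum_mono) (auto simp: nonneg split: split_indicator)
    thus "g z \<le> 1" by (simp add: sum1)
  qed
  have mp [measurable]: "(\<lambda>z. p (past X (n + 1) (fst z)) a) \<in> borel_measurable (completion ext)" for a
    by (rule measurable_completion) measurable
  have mX [measurable]: "(\<lambda>z. indicator {a} (X (n + 1) (fst z)) :: real) \<in> borel_measurable (completion ext)" for a
    by (rule measurable_completion) measurable
  have bdd: "integrable (completion ext) f"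
    if "f \<in> borel_measurable (completion ext)" "\<And>z. 0 \<le> f z" "\<And>z. f z \<le> 1" for f :: "_ \<Rightarrow> real"
    by (rule C.integrable_const_bound[where B = 1]) (use that in auto)
  \<comment> \<open>Testing against all of \<open>G_U n\<close>, and not just \<open>G_X n\<close>,
    is what makes \<open>C \<inter> B\<close> admissible below.\<close>
  have key: "(\<integral>z. indicator C z * indicator A z \<partial>completion ext) = (\<integral>z. indicator C z * g z \<partial>completion ext)"
    if C: "C \<in> sets (G_U n)" for C
  proof -
    have [measurable]: "C \<in> sets (completion ext)" using C GU by blast
    \<comment> \<open>Adaptedness enters here: the pieces \<open>A' a\<close> are events of the
      source.\<close>
    have CA: "C \<inter> A' a \<in> sets (G_U n)" for a using C A'(1)[of a] sub[of n] by blast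
    have "(\<integral>z. indicator C z * indicator A z \<partial>completion ext :: real) =
        (\<integral>z. (\<Sum>a\<in>UNIV. indicator (C \<inter> A' a) z * indicator {a} (X (n + 1) (fst z))) \<partial>completion ext)"
    proof (rule Bochner_Integration.integral_cong[OF refl])
      fix z assume z: "z \<in> space (completion ext)"
      have "(\<Sum>a\<in>UNIV. indicator (C \<inter> A' a) z * indicator {a} (X (n + 1) (fst z))) =
          (\<Sum>a\<in>UNIV. if a = X (n + 1) (fst z) then indicator (C \<inter> A' a) z else (0::real))"
        by (intro sum.cong) (auto split: split_indicator)
      also have "\<dots> = indicator C z * indicator A z"
        using z by (auto simp: A'(2) split: split_indicator)
      finally show "indicator C z * indicator A z =
          (\<Sum>a\<in>UNIV. indicator (C \<inter> A' a) z * indicator {a} (X (n + 1) (fst z)) :: real)" by simp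
    qed
    also have "\<dots> = (\<Sum>a\<in>UNIV. \<integral>z. indicator (C \<inter> A' a) z * indicator {a} (X (n + 1) (fst z)) \<partial>completion ext)"
      by (rule Bochner_Integration.integral_sum) (rule bdd, measurable, auto split: split_indicator)
    also have "\<dots> = (\<Sum>a\<in>UNIV. \<integral>z. indicator (C \<inter> A' a) z * p (past X (n + 1) (fst z)) a \<partial>completion ext)"
      by (intro sum.cong refl integral_next_letter CA)
    also have "\<dots> = (\<integral>z. (\<Sum>a\<in>UNIV. indicator (C \<inter> A' a) z * p (past X (n + 1) (fst z)) a) \<partial>completion ext)"
      by (rule Bochner_Integration.integral_sum[symmetric])
        (rule bdd, measurable, auto simp: nonneg le split: split_indicator)
    also have "\<dots> = (\<integral>z. indicator C z * g z \<partial>completion ext)"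
      by (rule Bochner_Integration.integral_cong)
        (auto simp: g_def sum_distrib_left indicator_inter_arith mult_ac)
    finally show ?thesis .
  qed
  have int_ind: "integrable (completion ext) (indicator D :: _ \<Rightarrow> real)" if "D \<in> sets (completion ext)" for D
    by (rule bdd) (use that in \<open>auto split: split_indicator\<close>)
  have rA: "AE z in completion ext. real_cond_exp (completion ext) (G_X n) (indicator A) z = g z"
  proof (rule S.real_cond_exp_charact)
    show "integrable (completion ext) (indicator A :: _ \<Rightarrow> real)" by (rule int_ind[OF mA])
    show "integrable (completion ext) g" by (rule bdd[OF g g01])
    show "(\<integral>z\<in>C. indicator A z \<partial>completion ext) = (\<integral>z\<in>C. g z \<partial>completion ext)" if "C \<in> sets (G_X n)" for C
      using key[of C] that sub[of n] by (auto simp: set_lebesgue_integral_def)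
  qed (rule g_GX)
  let ?rB = "real_cond_exp (completion ext) (G_X n) (indicator B)"
  have gB: "integrable (completion ext) (\<lambda>z. indicator C z * g z * indicator B z)" if "C \<in> sets (completion ext)" for C
    by (rule bdd) (use that g01 in \<open>auto split: split_indicator\<close>)
  have rAB: "AE z in completion ext. real_cond_exp (completion ext) (G_X n) (indicator (A \<inter> B)) z = g z * ?rB z"
  proof (rule S.real_cond_exp_charact)
    show "integrable (completion ext) (indicator (A \<inter> B) :: _ \<Rightarrow> real)" by (rule int_ind) measurable
    have "integrable (completion ext) (\<lambda>z. g z * indicator B z)"
      by (rule bdd) (use g01 in \<open>auto split: split_indicator\<close>)
    thus "integrable (completion ext) (\<lambda>z. g z * ?rB z)"
      by (rule S.real_cond_exp_intg(1)) (use g_GX in measurable)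
    show "(\<lambda>z. g z * ?rB z) \<in> borel_measurable (G_X n)" using g_GX by measurable
    fix C assume C: "C \<in> sets (G_X n)"
    hence mC: "C \<in> sets (completion ext)" using GX[of n] by (auto simp: subalgebra_def)
    have CB: "C \<inter> B \<in> sets (G_U n)" using C B sub[of n] by blast
    have "(\<integral>z\<in>C. indicator (A \<inter> B) z \<partial>completion ext :: real) = (\<integral>z. indicator (C \<inter> B) z * indicator A z \<partial>completion ext)"
      unfolding set_lebesgue_integral_def
      by (rule Bochner_Integration.integral_cong) (auto split: split_indicator)
    also have "\<dots> = (\<integral>z. indicator (C \<inter> B) z * g z \<partial>completion ext)" by (rule key[OF CB])
    also have "\<dots> = (\<integral>z. (indicator C z * g z) * indicator B z \<partial>completion ext)"
      by (rule Bochner_Integration.integral_cong) (auto split: split_indicator)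
    also have "\<dots> = (\<integral>z. (indicator C z * g z) * ?rB z \<partial>completion ext)"
      by (rule S.real_cond_exp_intg(2)[symmetric, OF gB[OF mC]]) (use g_GX C in measurable)
    also have "\<dots> = (\<integral>z\<in>C. g z * ?rB z \<partial>completion ext)"
      unfolding set_lebesgue_integral_def
      by (rule Bochner_Integration.integral_cong) auto
    finally show "(\<integral>z\<in>C. indicator (A \<inter> B) z \<partial>completion ext) = (\<integral>z\<in>C. g z * ?rB z \<partial>completion ext)" .
  qed
  show "AE z in completion ext. real_cond_exp (completion ext) (G_X n) (indicator (A \<inter> B)) z =
      real_cond_exp (completion ext) (G_X n) (indicator A) z * ?rB z"
    using rA rAB by eventually_elim simp
qed

lemma standard:
  assumes c: "0 \<le> c" "c * delta p 0 \<le> 1"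
    and div: "filterlim (\<lambda>K. \<Sum>k\<le>K. \<Prod>n\<le>k. 1 - c * delta p n) at_top sequentially"
  shows "standard_filtration M X"
  unfolding standard_filtration_def
proof (intro exI conjI allI)
  show "prob_space ext" by (rule prob_space_ext)
  show "fst \<in> measurable ext M" by (rule measurable_fst_ext)
  show "distr ext M fst = M" unfolding ext_def by (rule coords.P.distr_pair_fst)
  show "U n \<in> borel_measurable ext" for n by (rule measurable_U)
  show "prob_space.indep_vars ext (\<lambda>_. borel) U UNIV" by (rule indep_vars_U)
  show "distr ext borel (U n) = distr ext borel (U 0)" for n by (simp only: distr_U)
  have sub: "sets (G_X n) \<subseteq> sets (G_U n)" for n
    by (rule G_X_subset_G_U) (rule adapted[OF c div])
  show "immersed ext (count_space UNIV) lift_X borel U"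
    unfolding immersed_def using sub cond_indep[OF sub] by blast
qed

end

theorem theorem2:
  fixes M :: "'w measure" and X :: "int \<Rightarrow> 'w \<Rightarrow> 'a::finite"
    and p :: "(nat \<Rightarrow> 'a) \<Rightarrow> 'a \<Rightarrow> real"
  assumes "prob_space M"
    and "\<And>n. X n \<in> measurable M (count_space UNIV)"
    and "stationary M X"
    and "regular_cond_law M X p"
  shows "(2 * delta p 0 < 1 \<and>
          filterlim (\<lambda>K. \<Sum>k\<le>K. \<Prod>n\<le>k. 1 - 2 * delta p n) at_top sequentially
            \<longrightarrow> standard_filtration M X)
       \<and> (CARD('a) = 2 \<and>
          filterlim (\<lambda>K. \<Sum>k\<le>K. \<Prod>n\<le>k. 1 - delta p n) at_top sequentially
            \<longrightarrow> standard_filtration M X)"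
proof -
  have law: "\<And>x a. 0 \<le> p x a" "\<And>x. (\<Sum>a\<in>UNIV. p x a) = 1"
    "\<And>a. (\<lambda>x. p x a) \<in> borel_measurable past_space"
    using assms(4) unfolding regular_cond_law_def by auto
  have cl: "cond_law p" by unfold_locales (use law in auto)
  have process: "sampled_process \<mu> p c F M X" if "sampler \<mu> p c F" for \<mu> c F
    unfolding sampled_process_def sampled_process_axioms_def using that cl assms by blast
  show ?thesis
  proof (intro conjI impI; elim conjE)
    assume *: "2 * delta p 0 < 1"
      "filterlim (\<lambda>K. \<Sum>k\<le>K. \<Prod>n\<le>k. 1 - 2 * delta p n) at_top sequentially"
    obtain \<mu> F where "sampler \<mu> p 2 F" using ex_sampler_finite[of p] law by blast
    from sampled_process.standard[OF process[OF this]] * show "standard_filtration M X" by simp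
  next
    assume *: "CARD('a) = 2"
      "filterlim (\<lambda>K. \<Sum>k\<le>K. \<Prod>n\<le>k. 1 - delta p n) at_top sequentially"
    obtain \<mu> F where "sampler \<mu> p 1 F" using ex_sampler_binary[of p] *(1) law by blast
    \<comment> \<open>For \<open>c = 1\<close> the bound \<open>c * delta p 0 \<le> 1\<close> is
      automatic, since total variation never exceeds 1.\<close>
    from sampled_process.standard[OF process[OF this]] *(2) cond_law.delta_le_1[OF cl]
    show "standard_filtration M X" by simp
  qed
qed

end
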